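(* Let $\mathcal{P}$ be a thin polyomino. (A) Let $i\in\mathcal{O}=\{1,3,5,7\}$. The following are equivalent: (1) $\mathcal{M}$ forms a reduced Gröbner basis of $I_{\mathcal{P}}$ with respect to $<^i_{\mathrm{grevlex}}$; (2) there are no four cells $C,D,E,F$ having a common vertex $w$ with $C,D\notin\mathcal{P}$, $E,F\in\mathcal{P}$, where $C$, $D$, $E$, $F$ lie respectively at the upper left, lower right, lower left, upper right of $w$; and neither of the polyominoes $T_{\mathrm{i}}$, $T_{\mathrm{ii}}$ is, up to translation, a subpolyomino of $\mathcal{P}$. (B) Let $i\in\mathcal{E}=\{2,4,6,8\}$. The following are equivalent: (1) $\mathcal{M}$ forms a reduced Gröbner basis of $I_{\mathcal{P}}$ with respect to $<^i_{\mathrm{grevlex}}$; (2) there are no four cells $C,D,E,F$ having a common vertex $w$ with $C,D\notin\mathcal{P}$, $E,F\in\mathcal{P}$, where $C$, $D$, $E$, $F$ lie respectively at the lower left, upper right, upper left, lower right of $w$; and neither of the polyominoes $T_{\mathrm{iii}}$, $T_{\mathrm{iv}}$ is, up to translation, a subpolyomino of $\mathcal{P}$.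
   Context: **Polyominoes.** For $a=(i,j),b=(k,\ell)\in\mathbb{N}^2$ with $i\le k$, $j\le \ell$, the interval $[a,b]$ is $\{(r,s)\in\mathbb{N}^2: i\le r\le k,\ j\le s\le \ell\}$. It is proper if $i<k$ and $j<\ell$; then $a$ (lower left) and $b$ (upper right) are its diagonal corners, and $c=(i,\ell)$ (upper left) and $d=(k,j)$ (lower right) are its anti-diagonal corners. A cell is an interval $C=[a,a+(1,1)]$; its vertex set $V(C)$ consists of its four corners, and its edges are $\{a,a+(1,0)\}$, $\{a,a+(0,1)\}$, $\{a+(1,0),a+(1,1)\}$, $\{a+(0,1),a+(1,1)\}$. A polyomino is a finite collection $\mathcal{P}$ of cells such that any two cells $C,D$ of $\mathcal{P}$ are connected by a sequence of cells $C=C_1,\dots,C_m=D$ of $\mathcal{P}$ with $C_t\cap C_{t+1}$ an edge of $C_t$ for every $t<m$. Put $V(\mathcal{P})=\bigcup_{C\in\mathcal{P}}V(C)$. A proper interval $[a,b]$ is an inner interval of $\mathcal{P}$ if all cells contained in $[a,b]$ belong to $\mathcal{P}$. A polyomino $\mathcal{Q}$ is a subpolyomino of $\mathcal{P}$ if each cell of $\mathcal{Q}$ belongs to $\mathcal{P}$. A polyomino $\mathcal{P}$ is thin if it contains no four cells forming a $2\times 2$ square (i.e. no translate of the $2\times2$ square polyomino is a subpolyomino of $\mathcal{P}$). **Special polyominoes.** Writing $c(x,y)$ for the cell with lower left corner $(x,y)$: $T_{\mathrm{i}}=\{c(0,0),c(1,0),c(1,1),c(2,1)\}$, $T_{\mathrm{ii}}=\{c(0,0),c(0,1),c(1,1),c(1,2)\}$,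 $T_{\mathrm{iii}}=\{c(0,1),c(1,1),c(1,0),c(2,0)\}$, $T_{\mathrm{iv}}=\{c(0,1),c(0,2),c(1,0),c(1,1)\}$. "Up to translation" does not include rotations or reflections. **Polyomino ideal.** Let $\mathbb{K}$ be a field and $S=\mathbb{K}[x_v\mid v\in V(\mathcal{P})]$. $\mathcal{M}$ is the set of all inner 2-minors $x_ax_b-x_cx_d$, where $[a,b]$ ranges over the inner intervals of $\mathcal{P}$ and $c,d$ are the anti-diagonal corners of $[a,b]$; $I_{\mathcal{P}}\subset S$ is the ideal generated by $\mathcal{M}$. When speaking of reduced Gröbner bases, elements of $\mathcal{M}$ are taken up to sign so that leading coefficients are $1$. **Orders.** For $a=(a_1,a_2)$, $b=(b_1,b_2)$ in $V(\mathcal{P})$ define total orders $<^1,\dots,<^8$: - $a<^1b$ iff $a_1<b_1$, or $a_1=b_1$ and $a_2>b_2$; - $a<^2b$ iff $a_1>b_1$, or $a_1=b_1$ and $a_2>b_2$; - $a<^3b$ iff $a_1>b_1$, or $a_1=b_1$ and $a_2<b_2$; - $a<^4b$ iff $a_1<b_1$, or $a_1=b_1$ and $a_2<b_2$; - $a<^5b$ iff $a_2<b_2$, or $a_2=b_2$ and $a_1>b_1$; - $a<^6b$ iff $a_2<b_2$, or $a_2=b_2$ and $a_1<b_1$; - $a<^7b$ iff $a_2>b_2$, or $a_2=b_2$ and $a_1<b_1$; - $a<^8b$ iff $a_2>b_2$, or $a_2=b_2$ and $a_1>b_1$. $<^i_{\mathrm{grevlex}}$ is the graded reverse lexicographic monomial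 order on $S$ whose variables are ordered by $x_a<x_b$ iff $a<^ib$. *)

theory Defs
  imports
    "HOL-Library.Poly_Mapping"
    "HOL-Library.Product_Plus"
    "HOL-Library.Product_Order"
    "HOL-Algebra.Ideal"
begin

section \<open>Polyominoes\<close>

text \<open>
  Points of the grid are pairs of natural numbers with the componentwise order and addition, so the
  interval \<open>[a,b]\<close> is \<open>{a..b}\<close>. A cell \<open>[a, a + (1,1)]\<close> consists of exactly its four corners and
  therefore coincides with its vertex set.
\<close>

type_synonym point = "nat \<times> nat"

definition cell :: "point \<Rightarrow> point set" where
  "cell a = {a..a + (1, 1)}"

definition is_edge_of :: "point set \<Rightarrow> point set \<Rightarrow> bool" where
  "is_edge_of e C \<longleftrightarrow> (\<exists>a. C = cell a \<and>
     e \<in> {{a, a + (1, 0)}, {a, a + (0, 1)}, {a + (1, 0), a + (1, 1)}, {a + (0, 1), a + (1, 1)}})"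

definition polyomino :: "point set set \<Rightarrow> bool" where
  "polyomino P \<longleftrightarrow> finite P \<and> P \<subseteq> range cell \<and>
     (\<forall>C\<in>P. \<forall>D\<in>P. \<exists>Cs. Cs \<noteq> [] \<and> set Cs \<subseteq> P \<and> hd Cs = C \<and> last Cs = D \<and>
        (\<forall>t. Suc t < length Cs \<longrightarrow> is_edge_of (Cs ! t \<inter> Cs ! Suc t) (Cs ! t)))"

definition vertices :: "point set set \<Rightarrow> point set" where
  "vertices P = \<Union>P"

definition proper_interval :: "point \<Rightarrow> point \<Rightarrow> bool" where
  "proper_interval a b \<longleftrightarrow> fst a < fst b \<and> snd a < snd b"

definition inner_interval :: "point set set \<Rightarrow> point \<Rightarrow> point \<Rightarrow> bool" where
  "inner_interval P a b \<longleftrightarrow> proper_interval a b \<and> (\<forall>C\<in>range cell. C \<subseteq> {a..b} \<longrightarrow> C \<in> P)"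

definition subpolyomino :: "point set set \<Rightarrow> point set set \<Rightarrow> bool" where
  "subpolyomino Q P \<longleftrightarrow> polyomino Q \<and> Q \<subseteq> P"

definition translate :: "point \<Rightarrow> point set set \<Rightarrow> point set set" where
  "translate v Q = (\<lambda>C. (+) v ` C) ` Q"

text \<open>
  Below this is only used for polyominoes \<open>Q\<close> that touch both coordinate axes; the translates of such
  a \<open>Q\<close> inside the grid are exactly those by vectors with natural coordinates.
\<close>

definition contains_translate_of :: "point set set \<Rightarrow> point set set \<Rightarrow> bool" where
  "contains_translate_of P Q \<longleftrightarrow> (\<exists>v. subpolyomino (translate v Q) P)"

definition square2x2 :: "point set set" where
  "square2x2 = {cell (0, 0), cell (1, 0), cell (0, 1), cell (1, 1)}"

definition thin :: "point set set \<Rightarrow> bool" where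
  "thin P \<longleftrightarrow> \<not> contains_translate_of P square2x2"

definition T_i :: "point set set" where
  "T_i = {cell (0, 0), cell (1, 0), cell (1, 1), cell (2, 1)}"

definition T_ii :: "point set set" where
  "T_ii = {cell (0, 0), cell (0, 1), cell (1, 1), cell (1, 2)}"

definition T_iii :: "point set set" where
  "T_iii = {cell (0, 1), cell (1, 1), cell (1, 0), cell (2, 0)}"

definition T_iv :: "point set set" where
  "T_iv = {cell (0, 1), cell (0, 2), cell (1, 0), cell (1, 1)}"

text \<open>\<open>cell_upper_left w C\<close>: \<open>C\<close> is the cell with vertex \<open>w\<close> lying to the upper left of \<open>w\<close>, so \<open>w\<close> is
  the lower right corner of \<open>C\<close>; similarly for the other three.\<close>

definition cell_upper_left :: "point \<Rightarrow> point set \<Rightarrow> bool" where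
  "cell_upper_left w C \<longleftrightarrow> (\<exists>a. C = cell a \<and> w = a + (1, 0))"

definition cell_lower_right :: "point \<Rightarrow> point set \<Rightarrow> bool" where
  "cell_lower_right w C \<longleftrightarrow> (\<exists>a. C = cell a \<and> w = a + (0, 1))"

definition cell_lower_left :: "point \<Rightarrow> point set \<Rightarrow> bool" where
  "cell_lower_left w C \<longleftrightarrow> (\<exists>a. C = cell a \<and> w = a + (1, 1))"

definition cell_upper_right :: "point \<Rightarrow> point set \<Rightarrow> bool" where
  "cell_upper_right w C \<longleftrightarrow> (\<exists>a. C = cell a \<and> w = a)"


section \<open>Polynomials and Groebner bases\<close>

text \<open>
  A monomial is its finitely supported exponent function (monomials multiply by adding exponents), a
  polynomial is a finitely supported function from monomials to coefficients. The type
  \<open>('v, 'k) mpoly\<close> has one variable for every element of \<open>'v\<close>; \<open>poly_ring V\<close> is the polynomial ring in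
  the variables indexed by \<open>V\<close> only, and ideals are taken in that ring.
\<close>

type_synonym 'v mon = "'v \<Rightarrow>\<^sub>0 nat"
type_synonym ('v, 'k) mpoly = "('v \<Rightarrow>\<^sub>0 nat) \<Rightarrow>\<^sub>0 'k"

definition var :: "'v \<Rightarrow> ('v, 'k::comm_ring_1) mpoly" where
  "var v = Poly_Mapping.single (Poly_Mapping.single v 1) 1"

definition poly_ring :: "'v set \<Rightarrow> ('v, 'k::comm_ring_1) mpoly ring" where
  "poly_ring V = \<lparr>carrier = {f. \<forall>m\<in>Poly_Mapping.keys f. Poly_Mapping.keys m \<subseteq> V},
     mult = (*), one = 1, zero = 0, add = (+)\<rparr>"

definition mon_deg :: "'v mon \<Rightarrow> nat" where
  "mon_deg m = (\<Sum>v\<in>Poly_Mapping.keys m. Poly_Mapping.lookup m v)"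

definition mon_dvd :: "'v mon \<Rightarrow> 'v mon \<Rightarrow> bool" where
  "mon_dvd m n \<longleftrightarrow> (\<exists>u. n = m + u)"

text \<open>
  Graded reverse lexicographic order for the variable order \<open>lt\<close>: among monomials of equal degree,
  the smaller one has the larger exponent at the smallest variable where the two differ.
\<close>

definition grevlex :: "('v \<Rightarrow> 'v \<Rightarrow> bool) \<Rightarrow> 'v mon \<Rightarrow> 'v mon \<Rightarrow> bool" where
  "grevlex lt m n \<longleftrightarrow> mon_deg m < mon_deg n \<or>
     (mon_deg m = mon_deg n \<and>
      (\<exists>v. Poly_Mapping.lookup m v > Poly_Mapping.lookup n v \<and>
           (\<forall>w. lt w v \<longrightarrow> Poly_Mapping.lookup m w = Poly_Mapping.lookup n w)))"

definition lead_mon :: "('v mon \<Rightarrow> 'v mon \<Rightarrow> bool) \<Rightarrow> ('v, 'k::comm_ring_1) mpoly \<Rightarrow> 'v mon" where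
  "lead_mon ord f = (THE m. m \<in> Poly_Mapping.keys f \<and>
     (\<forall>n\<in>Poly_Mapping.keys f. n \<noteq> m \<longrightarrow> ord n m))"

definition lead_coef :: "('v mon \<Rightarrow> 'v mon \<Rightarrow> bool) \<Rightarrow> ('v, 'k::comm_ring_1) mpoly \<Rightarrow> 'k" where
  "lead_coef ord f = Poly_Mapping.lookup f (lead_mon ord f)"

definition initial :: "('v mon \<Rightarrow> 'v mon \<Rightarrow> bool) \<Rightarrow> ('v, 'k::comm_ring_1) mpoly \<Rightarrow> ('v, 'k) mpoly" where
  "initial ord f = Poly_Mapping.single (lead_mon ord f) 1"

definition groebner_basis ::
  "'v set \<Rightarrow> ('v mon \<Rightarrow> 'v mon \<Rightarrow> bool) \<Rightarrow> ('v, 'k::field) mpoly set \<Rightarrow> ('v, 'k) mpoly set \<Rightarrow> bool"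
where
  "groebner_basis V ord I G \<longleftrightarrow> finite G \<and> G \<subseteq> I - {0} \<and>
     Idl\<^bsub>poly_ring V\<^esub> (initial ord ` G) = Idl\<^bsub>poly_ring V\<^esub> (initial ord ` (I - {0}))"

definition reduced_groebner_basis ::
  "'v set \<Rightarrow> ('v mon \<Rightarrow> 'v mon \<Rightarrow> bool) \<Rightarrow> ('v, 'k::field) mpoly set \<Rightarrow> ('v, 'k) mpoly set \<Rightarrow> bool"
where
  "reduced_groebner_basis V ord I G \<longleftrightarrow> groebner_basis V ord I G \<and>
     (\<forall>g\<in>G. lead_coef ord g = 1) \<and>
     (\<forall>g\<in>G. \<forall>h\<in>G - {g}. \<forall>m\<in>Poly_Mapping.keys g. \<not> mon_dvd (lead_mon ord h) m)"


section \<open>The polyomino ideal\<close>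

text \<open>The anti-diagonal corners of \<open>[a,b]\<close> are \<open>(fst a, snd b)\<close> and \<open>(fst b, snd a)\<close>.\<close>

definition inner_minors :: "point set set \<Rightarrow> (point, 'k::field) mpoly set" where
  "inner_minors P = {var a * var b - var (fst a, snd b) * var (fst b, snd a) | a b.
     inner_interval P a b}"

definition polyomino_ideal :: "point set set \<Rightarrow> (point, 'k::field) mpoly set" where
  "polyomino_ideal P = Idl\<^bsub>poly_ring (vertices P)\<^esub> (inner_minors P)"

text \<open>The inner 2-minors have leading coefficient 1 or -1, so this picks from each pair of opposite
  minors the one with leading coefficient 1.\<close>

definition signed_inner_minors ::
  "(point mon \<Rightarrow> point mon \<Rightarrow> bool) \<Rightarrow> point set set \<Rightarrow> (point, 'k::field) mpoly set" where
  "signed_inner_minors ord P =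
     {f. (f \<in> inner_minors P \<or> - f \<in> inner_minors P) \<and> lead_coef ord f = 1}"

text \<open>The orders of index 1 to 8 on the vertices; other indices are not meaningful.\<close>

definition vertex_less :: "nat \<Rightarrow> point \<Rightarrow> point \<Rightarrow> bool" where
  "vertex_less i a b \<longleftrightarrow>
     (if i = 1 then fst a < fst b \<or> (fst a = fst b \<and> snd a > snd b)
      else if i = 2 then fst a > fst b \<or> (fst a = fst b \<and> snd a > snd b)
      else if i = 3 then fst a > fst b \<or> (fst a = fst b \<and> snd a < snd b)
      else if i = 4 then fst a < fst b \<or> (fst a = fst b \<and> snd a < snd b)
      else if i = 5 then snd a < snd b \<or> (snd a = snd b \<and> fst a > fst b)
      else if i = 6 then snd a < snd b \<or> (snd a = snd b \<and> fst a < fst b)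
      else if i = 7 then snd a > snd b \<or> (snd a = snd b \<and> fst a < fst b)
      else if i = 8 then snd a > snd b \<or> (snd a = snd b \<and> fst a > fst b)
      else False)"

end

theory Submission
  imports Defs
begin

text \<open>
  For odd \<open>i\<close> the smallest corner of a rectangle in the order \<open>i\<close> lies on the antidiagonal, so
  the leading term of a minor is its diagonal term; for even \<open>i\<close> it is the antidiagonal one, and the
  reflection \<open>x \<mapsto> - x\<close> exchanges the two situations. Everything is therefore proved once, for a set of
  cells with integer coordinates, and applied to the polyomino and to its mirror image.

  An inner minor is a difference of two monomials, hence a rule rewriting its leading monomial to the
  other one. If rewriting is confluent, the minors form a Groebner basis
  (\<open>groebner_basis_if_confluent\<close>): the sum of the coefficients over a union of classes of equivalent
  monomials vanishes on the ideal, and for the class of a leading monomial in normal form this sum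
  would be the leading coefficient. Conversely, if some monomial has two different reducts that are
  both in normal form, their difference lies in the ideal and its leading monomial is divisible by no
  leading monomial of a minor (\<open>groebner_basis_reducts\<close>). Reducedness is never an issue
  (\<open>rules_reduced\<close>).

  By Newman's lemma it remains to look at two rules whose left hand sides share one variable. If the rectangles have the
  same lower left or the same upper right corner, the reducts have a common reduct because the
  polyomino is thin (\<open>joinable_lower\<close>, \<open>joinable_upper\<close>). Otherwise the upper right corner \<open>w\<close> of one
  rectangle is the lower left corner of the other. If a third cell at \<open>w\<close> is present and there are no
  staircases of four cells, the two rectangles are a row and a column that can both be prolonged by
  the third cell, which makes the reducts meet (\<open>joinable_chain\<close>). If there is no third cell at \<open>w\<close>,
  or if there is a staircase, a product of three corners has two different normal forms
  (\<open>obstruction\<close>, \<open>obstruction_exists\<close>).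
\<close>

section \<open>Polynomial rings and monomial orders\<close>

lemma in_poly_ring_iff:
  "f \<in> carrier (poly_ring V) \<longleftrightarrow> (\<forall>m\<in>Poly_Mapping.keys f. Poly_Mapping.keys m \<subseteq> V)"
  by (simp add: poly_ring_def)

lemma poly_ring_simps [simp]:
  "f \<otimes>\<^bsub>poly_ring V\<^esub> g = f * g" "f \<oplus>\<^bsub>poly_ring V\<^esub> g = f + g"
  "\<zero>\<^bsub>poly_ring V\<^esub> = 0" "\<one>\<^bsub>poly_ring V\<^esub> = 1"
  by (simp_all add: poly_ring_def)

lemma ring_poly_ring: "ring (poly_ring V :: ('v, 'k::comm_ring_1) mpoly ring)"
proof (rule ringI)
  show "abelian_group (poly_ring V :: ('v, 'k) mpoly ring)"
  proof (rule abelian_groupI)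
    fix f :: "('v, 'k) mpoly"
    assume f: "f \<in> carrier (poly_ring V)"
    show "\<exists>g\<in>carrier (poly_ring V). g \<oplus>\<^bsub>poly_ring V\<^esub> f = \<zero>\<^bsub>poly_ring V\<^esub>"
      using f by (intro bexI[of _ "- f"]) (simp_all add: in_poly_ring_iff)
  next
    fix f g :: "('v, 'k) mpoly"
    assume "f \<in> carrier (poly_ring V)" "g \<in> carrier (poly_ring V)"
    then show "f \<oplus>\<^bsub>poly_ring V\<^esub> g \<in> carrier (poly_ring V)"
      using keys_add[of f g] by (auto simp: in_poly_ring_iff)
  qed (simp_all add: add.assoc add.commute in_poly_ring_iff)
  show "monoid (poly_ring V :: ('v, 'k) mpoly ring)"
  proof (rule monoidI)
    fix f g :: "('v, 'k) mpoly"
    assume fg: "f \<in> carrier (poly_ring V)" "g \<in> carrier (poly_ring V)"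
    have "Poly_Mapping.keys m \<subseteq> V" if "m \<in> Poly_Mapping.keys (f * g)" for m
    proof -
      from that keys_mult[of f g] obtain a b where
        "m = a + b" "a \<in> Poly_Mapping.keys f" "b \<in> Poly_Mapping.keys g"
        by blast
      then show ?thesis
        using fg keys_add[of a b] by (fastforce simp: in_poly_ring_iff)
    qed
    then show "f \<otimes>\<^bsub>poly_ring V\<^esub> g \<in> carrier (poly_ring V)"
      by (auto simp: in_poly_ring_iff)
  qed (simp_all add: mult.assoc in_poly_ring_iff)
qed (simp_all add: ring_distribs)

lemma poly_ring_closed:
  fixes f g :: "('v, 'k::comm_ring_1) mpoly"
  assumes "f \<in> carrier (poly_ring V)" "g \<in> carrier (poly_ring V)"
  shows add_in_poly_ring: "f + g \<in> carrier (poly_ring V)"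
    and mult_in_poly_ring: "f * g \<in> carrier (poly_ring V)"
  using ring.ring_simprules(1,5)[OF ring_poly_ring assms] by simp_all

lemma ideal_poly_ring_iff:
  fixes J :: "('v, 'k::comm_ring_1) mpoly set"
  shows "ideal J (poly_ring V) \<longleftrightarrow> J \<subseteq> carrier (poly_ring V) \<and> 0 \<in> J \<and>
    (\<forall>f\<in>J. \<forall>g\<in>J. f + g \<in> J) \<and> (\<forall>f\<in>J. \<forall>p\<in>carrier (poly_ring V). p * f \<in> J)"
    (is "_ \<longleftrightarrow> ?R")
proof
  assume "ideal J (poly_ring V)"
  then interpret ideal J "poly_ring V" .
  show ?R
  proof (intro conjI ballI)
    show "J \<subseteq> carrier (poly_ring V)"
      by (rule a_subset)
    show "0 \<in> J"
      using additive_subgroup.zero_closed[OF is_additive_subgroup] by simp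
    show "f + g \<in> J" if "f \<in> J" "g \<in> J" for f g
      using additive_subgroup.a_closed[OF is_additive_subgroup that] by simp
    show "p * f \<in> J" if "f \<in> J" "p \<in> carrier (poly_ring V)" for f p
      using I_l_closed[OF that] by simp
  qed
next
  assume R: ?R
  interpret ring "poly_ring V :: ('v, 'k) mpoly ring"
    by (rule ring_poly_ring)
  have neg: "- f \<in> J" if "f \<in> J" for f
  proof -
    have "- 1 \<in> carrier (poly_ring V :: ('v, 'k) mpoly ring)"
      by (auto simp: in_poly_ring_iff in_keys_iff lookup_one when_def split: if_splits)
    with that R have "- 1 * f \<in> J"
      by blast
    then show ?thesis by simp
  qed
  show "ideal J (poly_ring V)"
  proof (rule idealI)
    show "subgroup J (add_monoid (poly_ring V))"
    proof (rule add.subgroupI)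
      fix f assume "f \<in> J"
      have "\<ominus>\<^bsub>poly_ring V\<^esub> f = - f"
      proof (rule minus_equality)
        show "- f \<oplus>\<^bsub>poly_ring V\<^esub> f = \<zero>\<^bsub>poly_ring V\<^esub>"
          by (simp add: in_poly_ring_iff)
      qed (use \<open>f \<in> J\<close> neg R in auto)
      then show "\<ominus>\<^bsub>poly_ring V\<^esub> f \<in> J"
        using neg \<open>f \<in> J\<close> by simp
    qed (use R in \<open>auto simp: in_poly_ring_iff\<close>)
  next
    fix f p assume "f \<in> J" "p \<in> carrier (poly_ring V :: ('v, 'k) mpoly ring)"
    with R have "p * f \<in> J"
      by blast
    then show "p \<otimes>\<^bsub>poly_ring V\<^esub> f \<in> J" "f \<otimes>\<^bsub>poly_ring V\<^esub> p \<in> J"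
      by (simp_all add: in_poly_ring_iff mult.commute)
  qed (rule ring_axioms)
qed

lemma ideal_genideal_poly_ring:
  "S \<subseteq> carrier (poly_ring V) \<Longrightarrow> ideal (Idl\<^bsub>poly_ring V\<^esub> S) (poly_ring V)"
  by (rule ring.genideal_ideal[OF ring_poly_ring])

lemma subset_genideal_poly_ring:
  "S \<subseteq> carrier (poly_ring V) \<Longrightarrow> S \<subseteq> Idl\<^bsub>poly_ring V\<^esub> S"
  by (rule ring.genideal_self[OF ring_poly_ring])

lemma genideal_poly_ring_minimal:
  "ideal J (poly_ring V) \<Longrightarrow> S \<subseteq> J \<Longrightarrow> Idl\<^bsub>poly_ring V\<^esub> S \<subseteq> J"
  by (rule ring.genideal_minimal[OF ring_poly_ring])

lemma single_in_poly_ring: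
  "Poly_Mapping.keys m \<subseteq> V \<Longrightarrow> Poly_Mapping.single m c \<in> carrier (poly_ring V)"
  by (auto simp: in_poly_ring_iff split: if_splits)

lemma poly_eq_sum_singles:
  fixes f :: "'a \<Rightarrow>\<^sub>0 'b::comm_monoid_add"
  shows "f = (\<Sum>m\<in>Poly_Mapping.keys f. Poly_Mapping.single m (Poly_Mapping.lookup f m))"
proof (rule poly_mapping_eqI)
  fix k
  have "(\<Sum>m\<in>Poly_Mapping.keys f. if m = k then Poly_Mapping.lookup f m else 0) = Poly_Mapping.lookup f k"
    by (auto simp: in_keys_iff)
  then show "Poly_Mapping.lookup f k = Poly_Mapping.lookup
      (\<Sum>m\<in>Poly_Mapping.keys f. Poly_Mapping.single m (Poly_Mapping.lookup f m)) k"
    by (simp add: lookup_sum lookup_single when_def)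
qed

lemma keys_add_nat:
  fixes m n :: "'v mon"
  shows "Poly_Mapping.keys (m + n) = Poly_Mapping.keys m \<union> Poly_Mapping.keys n"
  by (auto simp: in_keys_iff lookup_add)

text \<open>
  A total order on monomials compatible with multiplication. Well-foundedness is not needed: the
  rewriting below is shown to end by a weight of its own.
\<close>

locale monomial_order =
  fixes less :: "'v mon \<Rightarrow> 'v mon \<Rightarrow> bool"
  assumes irrefl: "\<not> less m m"
    and trans: "less m n \<Longrightarrow> less n k \<Longrightarrow> less m k"
    and total: "m \<noteq> n \<Longrightarrow> less m n \<or> less n m"
    and add_right: "less m n \<Longrightarrow> less (m + k) (n + k)"
begin

lemma lead_mon_eqI:
  assumes "m \<in> Poly_Mapping.keys f" and "\<And>n. n \<in> Poly_Mapping.keys f \<Longrightarrow> n \<noteq> m \<Longrightarrow> less n m"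
  shows "lead_mon less f = m"
  unfolding lead_mon_def
  using assms by (intro the_equality) (metis irrefl trans)+

lemma lead_mon_greatest:
  assumes "f \<noteq> 0"
  shows lead_mon_in_keys: "lead_mon less f \<in> Poly_Mapping.keys f"
    and less_lead_mon: "n \<in> Poly_Mapping.keys f \<Longrightarrow> n \<noteq> lead_mon less f \<Longrightarrow> less n (lead_mon less f)"
proof -
  have "\<exists>m\<in>Poly_Mapping.keys f. \<forall>n\<in>Poly_Mapping.keys f. n \<noteq> m \<longrightarrow> less n m"
  proof (rule Finite_Set.bex_greatest_element)
    show "transp_on (Poly_Mapping.keys f) less"
      by (rule transp_onI) (meson trans)
    show "totalp_on (Poly_Mapping.keys f) less"
      by (rule totalp_onI) (meson total)
  qed (use assms in auto)
  then obtain m where m: "m \<in> Poly_Mapping.keys f" "\<And>n. n \<in> Poly_Mapping.keys f \<Longrightarrow> n \<noteq> m \<Longrightarrow> less n m"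
    by blast
  have "lead_mon less f = m"
    using m by (rule lead_mon_eqI)
  with m show "lead_mon less f \<in> Poly_Mapping.keys f"
    and "n \<in> Poly_Mapping.keys f \<Longrightarrow> n \<noteq> lead_mon less f \<Longrightarrow> less n (lead_mon less f)"
    by auto
qed

end

text \<open>The degree of a monomial when the variable \<open>v\<close> has degree \<open>f v\<close>.\<close>

definition weight :: "('v \<Rightarrow> nat) \<Rightarrow> 'v mon \<Rightarrow> nat" where
  "weight f m = (\<Sum>v\<in>Poly_Mapping.keys m. Poly_Mapping.lookup m v * f v)"

lemma weight_single [simp]: "weight f (Poly_Mapping.single v k) = k * f v"
  by (simp add: weight_def)

lemma weight_add: "weight f (m + n) = weight f m + weight f n"
  unfolding weight_def by (rule setsum_keys_plus_distrib) (auto simp: algebra_simps)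

lemma mon_deg_eq_weight: "mon_deg m = weight (\<lambda>_. 1) m"
  by (simp add: mon_deg_def weight_def)

lemma mon_deg_add: "mon_deg (m + n) = mon_deg m + mon_deg n"
  by (simp add: mon_deg_eq_weight weight_add)

lemma mon_deg_single [simp]: "mon_deg (Poly_Mapping.single v k) = k"
  by (simp add: mon_deg_def)

lemma monomial_order_grevlex:
  assumes irrefl: "\<And>v. \<not> lt v v"
    and trans: "\<And>u v w. lt u v \<Longrightarrow> lt v w \<Longrightarrow> lt u w"
    and total: "\<And>v w. v \<noteq> w \<Longrightarrow> lt v w \<or> lt w v"
  shows "monomial_order (grevlex lt)"
proof
  fix m n k :: "'a mon"
  show "\<not> grevlex lt m m"
    by (simp add: grevlex_def)
  show "grevlex lt (m + k) (n + k)" if "grevlex lt m n"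
    using that by (auto simp: grevlex_def mon_deg_add lookup_add)
  show "grevlex lt m k" if mn: "grevlex lt m n" and nk: "grevlex lt n k"
  proof (cases "mon_deg m = mon_deg n \<and> mon_deg n = mon_deg k")
    case False
    with mn nk show ?thesis by (auto simp: grevlex_def)
  next
    case True
    then obtain v where v: "Poly_Mapping.lookup m v > Poly_Mapping.lookup n v"
      "\<And>w. lt w v \<Longrightarrow> Poly_Mapping.lookup m w = Poly_Mapping.lookup n w"
      using mn by (auto simp: grevlex_def)
    from True obtain v' where v': "Poly_Mapping.lookup n v' > Poly_Mapping.lookup k v'"
      "\<And>w. lt w v' \<Longrightarrow> Poly_Mapping.lookup n w = Poly_Mapping.lookup k w"
      using nk by (auto simp: grevlex_def)
    consider "v = v'" | "lt v v'" | "lt v' v"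
      using total by blast
    then have "\<exists>v. Poly_Mapping.lookup m v > Poly_Mapping.lookup k v \<and>
        (\<forall>w. lt w v \<longrightarrow> Poly_Mapping.lookup m w = Poly_Mapping.lookup k w)"
    proof cases
      case 1
      with v v' show ?thesis by (intro exI[of _ v]) auto
    next
      case 2
      with v v' trans show ?thesis by (intro exI[of _ v]) (metis)
    next
      case 3
      with v v' trans show ?thesis by (intro exI[of _ v']) (metis)
    qed
    with True show ?thesis by (auto simp: grevlex_def)
  qed
  show "grevlex lt m n \<or> grevlex lt n m" if "m \<noteq> n"
  proof (cases "mon_deg m = mon_deg n")
    case False
    then show ?thesis by (auto simp: grevlex_def)
  next
    case True
    let ?D = "{v. Poly_Mapping.lookup m v \<noteq> Poly_Mapping.lookup n v}"
    have "\<exists>v\<in>?D. \<forall>w\<in>?D. w \<noteq> v \<longrightarrow> lt v w"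
    proof (rule Finite_Set.bex_least_element)
      show "finite ?D"
        by (rule finite_subset[of _ "Poly_Mapping.keys m \<union> Poly_Mapping.keys n"])
          (auto simp: in_keys_iff)
      show "transp_on ?D lt"
        by (rule transp_onI) (meson trans)
      show "totalp_on ?D lt"
        by (rule totalp_onI) (meson total)
      show "?D \<noteq> {}"
        using \<open>m \<noteq> n\<close> by (auto intro: poly_mapping_eqI)
    qed
    then obtain v where v: "Poly_Mapping.lookup m v \<noteq> Poly_Mapping.lookup n v"
      "\<And>w. Poly_Mapping.lookup m w \<noteq> Poly_Mapping.lookup n w \<Longrightarrow> w \<noteq> v \<Longrightarrow> lt v w"
      by blast
    then have "\<forall>w. lt w v \<longrightarrow> Poly_Mapping.lookup m w = Poly_Mapping.lookup n w"
      by (metis irrefl trans)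
    with v(1) True show ?thesis
      unfolding grevlex_def by (metis linorder_neqE_nat)
  qed
qed


section \<open>Groebner bases of pure binomials and rewriting of monomials\<close>

text \<open>
  A pair \<open>(u, v)\<close> of monomials is read both as the binomial \<open>u - v\<close> and as the rule that replaces a
  factor \<open>u\<close> of a monomial by \<open>v\<close>.
\<close>

definition binomials :: "('v mon \<times> 'v mon) set \<Rightarrow> ('v, 'k::comm_ring_1) mpoly set" where
  "binomials R = (\<lambda>(u, v). Poly_Mapping.single u 1 - Poly_Mapping.single v 1) ` R"

text \<open>One rewrite step; the cofactor \<open>t\<close> may involve any variables.\<close>

definition step :: "('v mon \<times> 'v mon) set \<Rightarrow> 'v mon \<Rightarrow> 'v mon \<Rightarrow> bool" where
  "step R m n \<longleftrightarrow> (\<exists>u v t. (u, v) \<in> R \<and> m = u + t \<and> n = v + t)"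

text \<open>Two elements with a common reduct.\<close>

definition joinable :: "('a \<Rightarrow> 'a \<Rightarrow> bool) \<Rightarrow> 'a \<Rightarrow> 'a \<Rightarrow> bool" where
  "joinable r m n \<longleftrightarrow> (\<exists>l. r\<^sup>*\<^sup>* m l \<and> r\<^sup>*\<^sup>* n l)"

text \<open>Newman's lemma: a terminating, locally confluent relation is confluent.\<close>

lemma joinable_if_locally_joinable:
  assumes wf: "wfP r\<inverse>\<inverse>"
    and local: "\<And>k m n. r k m \<Longrightarrow> r k n \<Longrightarrow> joinable r m n"
    and "r\<^sup>*\<^sup>* k m" "r\<^sup>*\<^sup>* k n"
  shows "joinable r m n"
  using assms(3,4)
proof (induction k arbitrary: m n rule: wfp_induct_rule[OF wf])
  case (1 k)
  note IH = "1.IH"[unfolded conversep_iff]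
  show ?case
  proof (cases "k = m \<or> k = n")
    case True
    with 1 show ?thesis by (auto simp: joinable_def)
  next
    case False
    obtain m1 where m1: "r k m1" "r\<^sup>*\<^sup>* m1 m"
      using "1.prems"(1) False by (metis converse_rtranclpE)
    obtain n1 where n1: "r k n1" "r\<^sup>*\<^sup>* n1 n"
      using "1.prems"(2) False by (metis converse_rtranclpE)
    obtain l where l: "r\<^sup>*\<^sup>* m1 l" "r\<^sup>*\<^sup>* n1 l"
      using local[OF m1(1) n1(1)] by (auto simp: joinable_def)
    obtain p where p: "r\<^sup>*\<^sup>* m p" "r\<^sup>*\<^sup>* l p"
      using IH[OF m1(1) m1(2) l(1)] by (auto simp: joinable_def)
    have "r\<^sup>*\<^sup>* n1 p"
      using l(2) p(2) by simp
    then obtain q where "r\<^sup>*\<^sup>* n q" "r\<^sup>*\<^sup>* p q"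
      using IH[OF n1(1) n1(2)] by (auto simp: joinable_def)
    then show ?thesis
      using p(1) by (auto simp: joinable_def intro: rtranclp_trans)
  qed
qed

text \<open>The sum of the coefficients of \<open>f\<close> at the monomials in \<open>S\<close>.\<close>

definition coeff_sum :: "'a set \<Rightarrow> ('a \<Rightarrow>\<^sub>0 'b::comm_monoid_add) \<Rightarrow> 'b" where
  "coeff_sum S f = (\<Sum>m\<in>Poly_Mapping.keys f. if m \<in> S then Poly_Mapping.lookup f m else 0)"

lemma coeff_sum_zero [simp]: "coeff_sum S 0 = 0"
  by (simp add: coeff_sum_def)

lemma coeff_sum_single [simp]:
  "coeff_sum S (Poly_Mapping.single m c) = (if m \<in> S then c else 0)"
  by (simp add: coeff_sum_def)

lemma coeff_sum_add: "coeff_sum S (f + g) = coeff_sum S f + coeff_sum S g"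
  unfolding coeff_sum_def by (rule setsum_keys_plus_distrib) auto

lemma coeff_sum_diff:
  fixes f g :: "'a \<Rightarrow>\<^sub>0 'b::ab_group_add"
  shows "coeff_sum S (f - g) = coeff_sum S f - coeff_sum S g"
  using coeff_sum_add[of S "f - g" g] by (simp add: algebra_simps)

lemma coeff_sum_sum: "coeff_sum S (sum h A) = (\<Sum>a\<in>A. coeff_sum S (h a))"
  by (induction A rule: infinite_finite_induct) (auto simp: coeff_sum_add)

lemma coeff_sum_single_mult:
  fixes f :: "('v, 'k::comm_ring_1) mpoly"
  shows "coeff_sum S (Poly_Mapping.single t c * f) = c * coeff_sum {m. t + m \<in> S} f"
proof -
  have "Poly_Mapping.single t c * f =
      (\<Sum>m\<in>Poly_Mapping.keys f. Poly_Mapping.single (t + m) (c * Poly_Mapping.lookup f m))"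
    by (subst (1) poly_eq_sum_singles[of f]) (simp add: sum_distrib_left mult_single)
  then show ?thesis
    by (simp add: coeff_sum_sum coeff_sum_def[of _ f] sum_distrib_left if_distrib cong: if_cong)
qed

lemma coeff_sum_mult:
  fixes f g :: "('v, 'k::comm_ring_1) mpoly"
  shows "coeff_sum S (g * f) =
    (\<Sum>t\<in>Poly_Mapping.keys g. Poly_Mapping.lookup g t * coeff_sum {m. t + m \<in> S} f)"
  by (subst poly_eq_sum_singles[of g])
    (simp add: sum_distrib_right coeff_sum_sum coeff_sum_single_mult)

text \<open>
  A set of monomials that is a union of classes of the equivalence generated by the rewrite steps
  defines a linear functional vanishing on the ideal generated by the binomials.
\<close>

lemma coeff_sum_binomial_ideal:
  fixes f :: "('v, 'k::comm_ring_1) mpoly"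
  assumes f: "f \<in> Idl\<^bsub>poly_ring V\<^esub> (binomials R)"
    and R: "\<And>u v. (u, v) \<in> R \<Longrightarrow> Poly_Mapping.keys u \<subseteq> V \<and> Poly_Mapping.keys v \<subseteq> V"
    and S: "\<And>m n. step R m n \<Longrightarrow> m \<in> S \<longleftrightarrow> n \<in> S"
  shows "coeff_sum S f = 0"
proof -
  define J :: "('v, 'k) mpoly set" where
    "J = {f \<in> carrier (poly_ring V). \<forall>S. (\<forall>m n. step R m n \<longrightarrow> (m \<in> S \<longleftrightarrow> n \<in> S)) \<longrightarrow> coeff_sum S f = 0}"
  interpret ring "poly_ring V :: ('v, 'k) mpoly ring"
    by (rule ring_poly_ring)
  have shift: "\<forall>m n. step R m n \<longrightarrow> (m \<in> {m. t + m \<in> S} \<longleftrightarrow> n \<in> {m. t + m \<in> S})"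
    if "\<forall>m n. step R m n \<longrightarrow> (m \<in> S \<longleftrightarrow> n \<in> S)" for S and t :: "'v mon"
  proof -
    have "step R (t + m) (t + n)" if "step R m n" for m n
      using that unfolding step_def by (metis add.left_commute)
    with that show ?thesis by blast
  qed
  have "ideal J (poly_ring V)"
    unfolding ideal_poly_ring_iff
  proof (intro conjI ballI)
    show "0 \<in> J"
      using zero_closed by (auto simp: J_def)
    fix f g assume fg: "f \<in> J" "g \<in> J"
    then show "f + g \<in> J"
      by (auto simp: J_def coeff_sum_add add_in_poly_ring)
  next
    fix f p assume "f \<in> J" and p: "p \<in> carrier (poly_ring V :: ('v, 'k) mpoly ring)"
    then have "p * f \<in> carrier (poly_ring V)"
      by (simp add: J_def mult_in_poly_ring)
    moreover have "coeff_sum S (p * f) = 0" if "\<forall>m n. step R m n \<longrightarrow> (m \<in> S \<longleftrightarrow> n \<in> S)" for S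
      using \<open>f \<in> J\<close> shift[OF that] by (simp add: J_def coeff_sum_mult)
    ultimately show "p * f \<in> J"
      by (auto simp: J_def)
  qed (auto simp: J_def)
  moreover have "binomials R \<subseteq> J"
  proof (clarsimp simp: binomials_def)
    fix u v assume uv: "(u, v) \<in> R"
    have "Poly_Mapping.keys (Poly_Mapping.single u (1::'k) - Poly_Mapping.single v 1) \<subseteq> {u, v}"
      by (auto simp: in_keys_iff lookup_minus lookup_single when_def split: if_splits)
    then have "Poly_Mapping.single u 1 - Poly_Mapping.single v 1 \<in> carrier (poly_ring V :: ('v, 'k) mpoly ring)"
      using R[OF uv] by (auto simp: in_poly_ring_iff)
    moreover have "step R u v"
      using uv unfolding step_def by (metis add.right_neutral)
    ultimately show "Poly_Mapping.single u 1 - Poly_Mapping.single v 1 \<in> J"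
      by (auto simp: J_def coeff_sum_diff)
  qed
  ultimately have "f \<in> J"
    using f genideal_poly_ring_minimal by blast
  with S show ?thesis by (auto simp: J_def)
qed

text \<open>A monomial in an ideal generated by monomials is divisible by one of the generators.\<close>

lemma single_in_monomial_ideal:
  assumes "Poly_Mapping.single m (1::'k::comm_ring_1) \<in>
      Idl\<^bsub>poly_ring V\<^esub> ((\<lambda>u. Poly_Mapping.single u 1) ` U)"
    and "\<And>u. u \<in> U \<Longrightarrow> Poly_Mapping.keys u \<subseteq> V"
  shows "\<exists>u\<in>U. mon_dvd u m"
proof -
  define J :: "('a, 'k) mpoly set" where
    "J = {f \<in> carrier (poly_ring V). \<forall>m\<in>Poly_Mapping.keys f. \<exists>u\<in>U. mon_dvd u m}"
  interpret ring "poly_ring V :: ('a, 'k) mpoly ring"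
    by (rule ring_poly_ring)
  have "ideal J (poly_ring V)"
    unfolding ideal_poly_ring_iff
  proof (intro conjI ballI)
    show "0 \<in> J"
      using zero_closed by (auto simp: J_def)
    fix f g assume fg: "f \<in> J" "g \<in> J"
    then show "f + g \<in> J"
      using keys_add[of f g] unfolding J_def by (auto simp: add_in_poly_ring)
  next
    fix f p assume f: "f \<in> J" and p: "p \<in> carrier (poly_ring V :: ('a, 'k) mpoly ring)"
    then have "p * f \<in> carrier (poly_ring V)"
      by (simp add: J_def mult_in_poly_ring)
    moreover have "\<exists>u\<in>U. mon_dvd u m" if "m \<in> Poly_Mapping.keys (p * f)" for m
    proof -
      obtain a b where "m = a + b" "b \<in> Poly_Mapping.keys f"
        using keys_mult[of p f] \<open>m \<in> _\<close> by blast
      then obtain u w where "u \<in> U" "b = u + w"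
        using f by (auto simp: J_def mon_dvd_def)
      with \<open>m = a + b\<close> show ?thesis
        unfolding mon_dvd_def by (metis add.left_commute)
    qed
    ultimately show "p * f \<in> J"
      by (auto simp: J_def)
  qed (auto simp: J_def)
  moreover have "(\<lambda>u. Poly_Mapping.single u 1) ` U \<subseteq> J"
    using assms(2) by (auto simp: J_def single_in_poly_ring mon_dvd_def intro!: bexI exI[of _ 0])
  ultimately have "Poly_Mapping.single m (1::'k) \<in> J"
    using assms(1) genideal_poly_ring_minimal by blast
  then show ?thesis by (simp add: J_def)
qed

text \<open>
  Finitely many rules in the variables \<open>V\<close>, each replacing a monomial by a smaller one; so the left
  hand side of a rule is the leading monomial of its binomial.
\<close>

locale binomial_rules = monomial_order less
  for less :: "'v mon \<Rightarrow> 'v mon \<Rightarrow> bool" +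
  fixes V :: "'v set" and R :: "('v mon \<times> 'v mon) set"
  assumes finite_rules: "finite R"
    and rule_vars: "(u, v) \<in> R \<Longrightarrow> Poly_Mapping.keys u \<subseteq> V \<and> Poly_Mapping.keys v \<subseteq> V"
    and rule_less: "(u, v) \<in> R \<Longrightarrow> less v u"
begin

lemma keys_binomial:
  assumes "(u, v) \<in> R"
  shows "Poly_Mapping.keys (Poly_Mapping.single u (1::'k::comm_ring_1) - Poly_Mapping.single v 1) = {u, v}"
  using rule_less[OF assms] irrefl
  by (auto simp: in_keys_iff lookup_minus lookup_single when_def split: if_splits)

lemma lead_mon_binomial:
  assumes "(u, v) \<in> R"
  shows "lead_mon less (Poly_Mapping.single u (1::'k::comm_ring_1) - Poly_Mapping.single v 1) = u"
  using rule_less[OF assms] by (intro lead_mon_eqI) (auto simp: keys_binomial[OF assms])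

lemma lead_coef_binomial:
  assumes "(u, v) \<in> R"
  shows "lead_coef less (Poly_Mapping.single u (1::'k::comm_ring_1) - Poly_Mapping.single v 1) = 1"
  using rule_less[OF assms] irrefl unfolding lead_coef_def lead_mon_binomial[OF assms]
  by (auto simp: lookup_minus lookup_single when_def)

lemma initial_binomials:
  "initial less ` (binomials R :: ('v, 'k::comm_ring_1) mpoly set) =
    (\<lambda>u. Poly_Mapping.single u 1) ` fst ` R"
proof -
  have "initial less (Poly_Mapping.single u 1 - Poly_Mapping.single v 1 :: ('v, 'k) mpoly) =
      Poly_Mapping.single u 1" if "(u, v) \<in> R" for u v
    using that by (simp add: initial_def lead_mon_binomial)
  then show ?thesis
    unfolding binomials_def image_image by (intro image_cong) auto
qed

lemma binomials_carrier: "binomials R \<subseteq> carrier (poly_ring V :: ('v, 'k::comm_ring_1) mpoly ring)"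
proof (clarsimp simp: binomials_def)
  fix u v assume "(u, v) \<in> R"
  from rule_vars[OF this] show "Poly_Mapping.single u 1 - Poly_Mapping.single v 1 \<in>
      carrier (poly_ring V :: ('v, 'k) mpoly ring)"
    by (auto simp: in_poly_ring_iff keys_binomial[OF \<open>(u, v) \<in> R\<close>])
qed

lemma binomial_ideal_carrier:
  "Idl\<^bsub>poly_ring V\<^esub> (binomials R) \<subseteq> carrier (poly_ring V :: ('v, 'k::comm_ring_1) mpoly ring)"
  using ideal_genideal_poly_ring[OF binomials_carrier] unfolding ideal_poly_ring_iff by blast

lemma binomials_in_ideal:
  "(binomials R :: ('v, 'k::comm_ring_1) mpoly set) \<subseteq> Idl\<^bsub>poly_ring V\<^esub> (binomials R) - {0}"
proof -
  have "0 \<notin> (binomials R :: ('v, 'k) mpoly set)"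
    unfolding binomials_def using keys_binomial[where 'k = 'k] by fastforce
  then show ?thesis
    using subset_genideal_poly_ring[OF binomials_carrier] by blast
qed

lemma initial_carrier:
  fixes f :: "('v, 'k::comm_ring_1) mpoly"
  assumes "f \<in> carrier (poly_ring V)" "f \<noteq> 0"
  shows "initial less f \<in> carrier (poly_ring V)"
  unfolding initial_def using lead_mon_in_keys[OF assms(2)] assms(1)
  by (intro single_in_poly_ring) (auto simp: in_poly_ring_iff)

lemma rtranclp_step_less: "(step R)\<^sup>*\<^sup>* m n \<Longrightarrow> m = n \<or> less n m"
proof (induction rule: rtranclp_induct)
  case (step n k)
  then have "less k n"
    using rule_less add_right by (auto simp: step_def)
  with step show ?case using trans by blast
qed auto

text \<open>
  If \<open>f\<close> lies in the ideal and its leading monomial \<open>l\<close> is a normal form, then by confluence the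
  monomials that rewrite to \<open>l\<close> form a union of classes; all of them except \<open>l\<close> exceed \<open>l\<close>, so the
  coefficient sum of \<open>f\<close> over this set is the leading coefficient of \<open>f\<close>. But the sum vanishes because \<open>f\<close>
  is in the ideal.
\<close>

theorem groebner_basis_if_confluent:
  assumes confl: "\<And>k m n. (step R)\<^sup>*\<^sup>* k m \<Longrightarrow> (step R)\<^sup>*\<^sup>* k n \<Longrightarrow> joinable (step R) m n"
  shows "groebner_basis V less (Idl\<^bsub>poly_ring V\<^esub> (binomials R))
    (binomials R :: ('v, 'k::field) mpoly set)"
proof -
  let ?I = "Idl\<^bsub>poly_ring V\<^esub> (binomials R) :: ('v, 'k) mpoly set"
  let ?init = "Idl\<^bsub>poly_ring V\<^esub> (initial less ` binomials R) :: ('v, 'k) mpoly set"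
  have carr: "initial less ` (?I - {0}) \<subseteq> carrier (poly_ring V)"
    using initial_carrier binomial_ideal_carrier by blast
  have carr': "initial less ` binomials R \<subseteq> carrier (poly_ring V :: ('v, 'k) mpoly ring)"
    using carr binomials_in_ideal by blast
  have init: "ideal ?init (poly_ring V)"
    by (rule ideal_genideal_poly_ring[OF carr'])
  have "initial less f \<in> ?init" if f: "f \<in> ?I" "f \<noteq> 0" for f
  proof -
    let ?l = "lead_mon less f"
    have "\<exists>n. step R ?l n"
    proof (rule ccontr)
      assume irred: "\<nexists>n. step R ?l n"
      define S where "S = {m. (step R)\<^sup>*\<^sup>* m ?l}"
      have "m \<in> S \<longleftrightarrow> n \<in> S" if "step R m n" for m n
      proof
        assume "m \<in> S"
        then obtain l where "(step R)\<^sup>*\<^sup>* n l" "(step R)\<^sup>*\<^sup>* ?l l"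
          using confl[of m n ?l] \<open>step R m n\<close> by (auto simp: S_def joinable_def)
        then show "n \<in> S"
          using irred by (auto simp: S_def elim: converse_rtranclpE)
      qed (use that in \<open>auto simp: S_def\<close>)
      then have "coeff_sum S f = 0"
        using coeff_sum_binomial_ideal[OF f(1)] rule_vars by blast
      moreover have "coeff_sum S f = (\<Sum>m\<in>Poly_Mapping.keys f. if m = ?l then Poly_Mapping.lookup f m else 0)"
        unfolding coeff_sum_def
      proof (rule sum.cong[OF refl])
        fix m assume "m \<in> Poly_Mapping.keys f"
        then have "m \<in> S \<longleftrightarrow> m = ?l"
          using rtranclp_step_less[of m ?l] less_lead_mon[OF f(2), of m] irrefl trans
          by (auto simp: S_def)
        then show "(if m \<in> S then Poly_Mapping.lookup f m else 0) =
            (if m = ?l then Poly_Mapping.lookup f m else 0)"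
          by simp
      qed
      ultimately show False
        using lead_mon_in_keys[OF f(2)] by (simp add: in_keys_iff)
    qed
    then obtain u v t where uv: "(u, v) \<in> R" "?l = t + u"
      unfolding step_def by (metis add.commute)
    have "Poly_Mapping.keys ?l \<subseteq> V"
      using f binomial_ideal_carrier lead_mon_in_keys[OF f(2)] by (fastforce simp: in_poly_ring_iff)
    then have "Poly_Mapping.single t 1 \<in> carrier (poly_ring V :: ('v, 'k) mpoly ring)"
      by (intro single_in_poly_ring) (auto simp: uv(2) keys_add_nat)
    moreover have "Poly_Mapping.single u 1 \<in> ?init"
      using subset_genideal_poly_ring[OF carr'] uv(1) by (force simp: initial_binomials)
    ultimately have "Poly_Mapping.single t 1 * Poly_Mapping.single u 1 \<in> ?init"
      using init unfolding ideal_poly_ring_iff by blast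
    then show ?thesis
      by (simp add: initial_def uv(2) mult_single)
  qed
  then have "Idl\<^bsub>poly_ring V\<^esub> (initial less ` (?I - {0})) \<subseteq> ?init"
    by (intro genideal_poly_ring_minimal[OF init]) auto
  moreover have "?init \<subseteq> Idl\<^bsub>poly_ring V\<^esub> (initial less ` (?I - {0}))"
    using subset_genideal_poly_ring[OF carr] binomials_in_ideal
    by (intro genideal_poly_ring_minimal[OF ideal_genideal_poly_ring[OF carr]]) blast
  moreover have "finite (binomials R :: ('v, 'k) mpoly set)"
    using finite_rules by (simp add: binomials_def)
  ultimately show ?thesis
    using binomials_in_ideal by (simp add: groebner_basis_def)
qed

text \<open>
  Conversely, two different reducts of one monomial differ by an element of the ideal, and the leading
  monomial of this difference is one of them.
\<close>

lemma groebner_basis_reducts: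
  assumes gb: "groebner_basis V less (Idl\<^bsub>poly_ring V\<^esub> (binomials R))
      (binomials R :: ('v, 'k::field) mpoly set)"
    and k: "Poly_Mapping.keys k \<subseteq> V" and km: "step R k m" and kn: "step R k n" and "m \<noteq> n"
  shows "\<exists>l. step R m l \<or> step R n l"
proof -
  let ?I = "Idl\<^bsub>poly_ring V\<^esub> (binomials R) :: ('v, 'k) mpoly set"
  have I: "ideal ?I (poly_ring V)"
    by (rule ideal_genideal_poly_ring[OF binomials_carrier])
  have diff: "Poly_Mapping.single k 1 - Poly_Mapping.single m 1 \<in> ?I" 
    and neg: "Poly_Mapping.single m 1 - Poly_Mapping.single k 1 \<in> ?I" if "step R k m" for m
  proof -
    from that obtain u v t where uv: "(u, v) \<in> R" "k = t + u" "m = t + v"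
      unfolding step_def by (metis add.commute)
    have "Poly_Mapping.single t c \<in> carrier (poly_ring V :: ('v, 'k) mpoly ring)" for c
      using k by (intro single_in_poly_ring) (auto simp: uv(2) keys_add_nat)
    moreover have "Poly_Mapping.single u 1 - Poly_Mapping.single v 1 \<in> ?I"
      using binomials_in_ideal uv(1) by (force simp: binomials_def)
    ultimately have "Poly_Mapping.single t c * (Poly_Mapping.single u 1 - Poly_Mapping.single v 1) \<in> ?I" for c
      using I unfolding ideal_poly_ring_iff by blast
    from this[of 1] this[of "- 1"]
    show "Poly_Mapping.single k 1 - Poly_Mapping.single m 1 \<in> ?I"
      and "Poly_Mapping.single m 1 - Poly_Mapping.single k 1 \<in> ?I"
      by (simp_all add: uv(2,3) mult_single right_diff_distrib single_uminus)
  qed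
  define f :: "('v, 'k) mpoly" where "f = Poly_Mapping.single m 1 - Poly_Mapping.single n 1"
  have "(Poly_Mapping.single m 1 - Poly_Mapping.single k 1) +
      (Poly_Mapping.single k 1 - Poly_Mapping.single n 1) \<in> ?I"
    using diff[OF kn] neg[OF km] I unfolding ideal_poly_ring_iff by blast
  then have "f \<in> ?I"
    by (simp add: f_def)
  have keys: "Poly_Mapping.keys f = {m, n}"
    using \<open>m \<noteq> n\<close> by (auto simp: f_def in_keys_iff lookup_minus lookup_single when_def split: if_splits)
  then have "f \<noteq> 0" by auto
  have "initial less f \<in> Idl\<^bsub>poly_ring V\<^esub> (initial less ` (?I - {0}))"
    using \<open>f \<in> ?I\<close> \<open>f \<noteq> 0\<close> initial_carrier binomial_ideal_carrier
    by (intro subsetD[OF subset_genideal_poly_ring]) blast+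
  then have "Poly_Mapping.single (lead_mon less f) 1 \<in>
      Idl\<^bsub>poly_ring V\<^esub> ((\<lambda>u. Poly_Mapping.single u (1::'k)) ` fst ` R)"
    using gb unfolding groebner_basis_def initial_binomials by (simp add: initial_def[of _ f])
  then have "\<exists>u\<in>fst ` R. mon_dvd u (lead_mon less f)"
    by (rule single_in_monomial_ideal) (use rule_vars in force)
  then have "\<exists>l. step R (lead_mon less f) l"
    unfolding mon_dvd_def step_def by force
  moreover have "lead_mon less f \<in> {m, n}"
    using lead_mon_in_keys[OF \<open>f \<noteq> 0\<close>] keys by simp
  ultimately show ?thesis by auto
qed

end


lemma single_add_eqE:
  fixes m n :: "'v mon"
  assumes "Poly_Mapping.single a 1 + m = Poly_Mapping.single b 1 + n"
  obtains "a = b" "m = n"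
  | t where "a \<noteq> b" "m = Poly_Mapping.single b 1 + t" "n = Poly_Mapping.single a 1 + t"
proof (cases "a = b")
  case True
  with assms that(1) show thesis by simp
next
  case False
  let ?a = "Poly_Mapping.single a 1" and ?b = "Poly_Mapping.single b 1"
  have eq: "Poly_Mapping.lookup ?a v + Poly_Mapping.lookup m v =
      Poly_Mapping.lookup ?b v + Poly_Mapping.lookup n v" for v
    using assms by (metis lookup_add)
  have "n = ?a + (n - ?a)"
  proof (rule poly_mapping_eqI)
    fix v show "Poly_Mapping.lookup n v = Poly_Mapping.lookup (?a + (n - ?a)) v"
      using eq[of v] False by (auto simp: lookup_add lookup_minus lookup_single when_def)
  qed
  moreover have "m = ?b + (n - ?a)"
  proof (rule poly_mapping_eqI)
    fix v show "Poly_Mapping.lookup m v = Poly_Mapping.lookup (?b + (n - ?a)) v"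
      using eq[of v] False by (auto simp: lookup_add lookup_minus lookup_single when_def)
  qed
  ultimately show thesis using that(2) False by blast
qed

lemma step_add: "step R m n \<Longrightarrow> step R (m + t) (n + t)"
  unfolding step_def by (metis add.assoc)

lemma rtranclp_step_add: "(step R)\<^sup>*\<^sup>* m n \<Longrightarrow> (step R)\<^sup>*\<^sup>* (m + t) (n + t)"
  by (induction rule: rtranclp_induct) (auto intro: step_add rtranclp.rtrancl_into_rtrancl)

lemma joinable_step_add: "joinable (step R) m n \<Longrightarrow> joinable (step R) (m + t) (n + t)"
  unfolding joinable_def by (meson rtranclp_step_add)

lemma joinable_sym: "joinable r m n \<Longrightarrow> joinable r n m"
  by (auto simp: joinable_def)

lemma joinable_one_step: "r m l \<Longrightarrow> r n l \<Longrightarrow> joinable r m n"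
  by (auto simp: joinable_def)

lemma joinable_single_step: "r m n \<Longrightarrow> joinable r m n"
  by (auto simp: joinable_def)

section \<open>Rectangles of cells and their rewrite rules\<close>

text \<open>
  The condition on the shape, where \<open>Q\<close> is the set of the lower left corners of cells. Excluded are a
  point whose lower left and upper right cells are present while the other two cells around it are
  missing, and the horizontal and the vertical staircase of four cells.
\<close>

definition obstruction_free :: "(int \<Rightarrow> int \<Rightarrow> bool) \<Rightarrow> bool" where
  "obstruction_free Q \<longleftrightarrow>
    (\<forall>i j. \<not> (Q i j \<and> Q (i + 1) (j + 1) \<and> \<not> Q i (j + 1) \<and> \<not> Q (i + 1) j)) \<and>
    (\<forall>i j. \<not> (Q i j \<and> Q (i + 1) j \<and> Q (i + 1) (j + 1) \<and> Q (i + 2) (j + 1))) \<and>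
    (\<forall>i j. \<not> (Q i j \<and> Q i (j + 1) \<and> Q (i + 1) (j + 1) \<and> Q (i + 1) (j + 2)))"

text \<open>
  \<open>Q i j\<close> says that the cell with lower left corner \<open>(i, j)\<close> is present; \<open>X x y\<close> is the variable at the
  grid point \<open>(x, y)\<close>. Coordinates are integers so that a reflected polyomino is again an instance.
  Only variables at corners of present cells have to determine their coordinates.
\<close>

locale cell_grid =
  fixes X :: "int \<Rightarrow> int \<Rightarrow> 'v" and cx cy :: "'v \<Rightarrow> int" and Q :: "int \<Rightarrow> int \<Rightarrow> bool"
  assumes coords: "Q i j \<Longrightarrow> x \<in> {i, i + 1} \<Longrightarrow> y \<in> {j, j + 1} \<Longrightarrow> cx (X x y) = x \<and> cy (X x y) = y"
    and thin: "\<not> (Q i j \<and> Q (i + 1) j \<and> Q i (j + 1) \<and> Q (i + 1) (j + 1))"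
begin

text \<open>All cells of the rectangle with lower left corner \<open>(x1, y1)\<close> and upper right corner \<open>(x2, y2)\<close>
  are present.\<close>

definition inner :: "int \<Rightarrow> int \<Rightarrow> int \<Rightarrow> int \<Rightarrow> bool" where
  "inner x1 y1 x2 y2 \<longleftrightarrow> x1 < x2 \<and> y1 < y2 \<and> (\<forall>i j. x1 \<le> i \<and> i < x2 \<and> y1 \<le> j \<and> j < y2 \<longrightarrow> Q i j)"

text \<open>The variable at \<open>(x, y)\<close> as a monomial.\<close>

definition xv :: "int \<Rightarrow> int \<Rightarrow> 'v mon" where
  "xv x y = Poly_Mapping.single (X x y) 1"

lemma xv_fold: "Poly_Mapping.single (X x y) (Suc 0) = xv x y"
  by (simp add: xv_def)

text \<open>The variable at \<open>(x, y)\<close> determines \<open>x\<close> and \<open>y\<close>.\<close>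

definition corner :: "int \<Rightarrow> int \<Rightarrow> bool" where
  "corner x y \<longleftrightarrow> cx (X x y) = x \<and> cy (X x y) = y"

text \<open>In every full rectangle, the product of the lower left and the upper right corner is replaced by
  the product of the other two corners.\<close>

definition rules :: "('v mon \<times> 'v mon) set" where
  "rules = {(xv x1 y1 + xv x2 y2, xv x1 y2 + xv x2 y1) | x1 y1 x2 y2. inner x1 y1 x2 y2}"

lemma corner_eq_iff: "corner x y \<Longrightarrow> corner x' y' \<Longrightarrow> X x y = X x' y' \<longleftrightarrow> x = x' \<and> y = y'"
  unfolding corner_def by metis

lemma inner_corners:
  assumes "inner x1 y1 x2 y2"
  shows "corner x1 y1" "corner x2 y2" "corner x1 y2" "corner x2 y1"
proof -
  have "Q x1 y1" "Q (x2 - 1) (y2 - 1)" "Q x1 (y2 - 1)" "Q (x2 - 1) y1"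
    using assms by (auto simp: inner_def)
  then show "corner x1 y1" "corner x2 y2" "corner x1 y2" "corner x2 y1"
    using coords unfolding corner_def by fastforce+
qed

lemma inner_less: "inner x1 y1 x2 y2 \<Longrightarrow> x1 < x2 \<and> y1 < y2"
  by (simp add: inner_def)

lemma inner_cell: "inner x1 y1 x2 y2 \<Longrightarrow> x1 \<le> i \<Longrightarrow> i < x2 \<Longrightarrow> y1 \<le> j \<Longrightarrow> j < y2 \<Longrightarrow> Q i j"
  by (simp add: inner_def)

lemma inner_mono:
  "inner x1 y1 x2 y2 \<Longrightarrow> x1 \<le> x1' \<Longrightarrow> x1' < x2' \<Longrightarrow> x2' \<le> x2 \<Longrightarrow>
    y1 \<le> y1' \<Longrightarrow> y1' < y2' \<Longrightarrow> y2' \<le> y2 \<Longrightarrow> inner x1' y1' x2' y2'"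
  by (auto simp: inner_def)

lemma inner_rowI: "x1 < x2 \<Longrightarrow> (\<And>i. x1 \<le> i \<Longrightarrow> i < x2 \<Longrightarrow> Q i y) \<Longrightarrow> inner x1 y x2 (y + 1)"
  unfolding inner_def by (metis less_add_one order_antisym zle_add1_eq_le)

lemma inner_columnI: "y1 < y2 \<Longrightarrow> (\<And>j. y1 \<le> j \<Longrightarrow> j < y2 \<Longrightarrow> Q x j) \<Longrightarrow> inner x y1 (x + 1) y2"
  unfolding inner_def by (metis less_add_one order_antisym zle_add1_eq_le)

lemma inner_thin:
  assumes "inner x1 y1 x2 y2"
  shows "x2 = x1 + 1 \<or> y2 = y1 + 1"
proof (rule ccontr)
  assume "\<not> ?thesis"
  with inner_less[OF assms] have "x1 + 1 < x2" "y1 + 1 < y2" by auto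
  then have "Q x1 y1" "Q (x1 + 1) y1" "Q x1 (y1 + 1)" "Q (x1 + 1) (y1 + 1)"
    by (auto intro: inner_cell[OF assms])
  with thin show False by blast
qed

lemma step_rule:
  assumes "inner x1 y1 x2 y2" "m = xv x1 y1 + xv x2 y2 + t" "n = xv x1 y2 + xv x2 y1 + t"
  shows "step rules m n"
  using assms unfolding step_def rules_def by blast

lemma step_ruleE:
  assumes "step rules m n"
  obtains x1 y1 x2 y2 t where "inner x1 y1 x2 y2" "m = xv x1 y1 + xv x2 y2 + t"
    "n = xv x1 y2 + xv x2 y1 + t"
  using assms unfolding step_def rules_def by blast

lemma joinable_two_steps:
  assumes "inner x1 y1 x2 y2" "inner x3 y3 x4 y4"
    and "m = xv x1 y1 + xv x2 y2 + s" "n = xv x3 y3 + xv x4 y4 + t"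
    and "xv x1 y2 + xv x2 y1 + s = xv x3 y4 + xv x4 y3 + t"
  shows "joinable (step rules) m n"
  using step_rule[OF assms(1,3) refl] step_rule[OF assms(2,4) assms(5)]
  by (rule joinable_one_step)

text \<open>
  Rewriting ends, as it lowers the sum of \<open>(x + y)\<^sup>2\<close> over the variables of a monomial, counted with
  multiplicity: a step on the rectangle with corners \<open>(x1, y1)\<close> and \<open>(x2, y2)\<close> lowers it by \<open>2 * (x2 - x1) * (y2 - y1)\<close>.
\<close>

lemma wf_step: "wfP (step rules)\<inverse>\<inverse>"
proof -
  let ?w = "weight (\<lambda>v. nat ((cx v + cy v)\<^sup>2))"
  have "?w n < ?w m" if "step rules m n" for m n
  proof -
    from that obtain x1 y1 x2 y2 t where r: "inner x1 y1 x2 y2"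
      and mn: "m = xv x1 y1 + xv x2 y2 + t" "n = xv x1 y2 + xv x2 y1 + t"
      by (rule step_ruleE)
    have "0 < (x2 - x1) * (y2 - y1)"
      using inner_less[OF r] by simp
    then have "(x1 + y2)\<^sup>2 + (x2 + y1)\<^sup>2 < (x1 + y1)\<^sup>2 + (x2 + y2)\<^sup>2"
      by (simp add: power2_eq_square algebra_simps)
    then have "nat ((x1 + y2)\<^sup>2) + nat ((x2 + y1)\<^sup>2) < nat ((x1 + y1)\<^sup>2) + nat ((x2 + y2)\<^sup>2)"
      by (simp flip: of_nat_less_iff[where 'a = int])
    then show ?thesis
      using inner_corners[OF r] by (simp add: mn weight_add xv_def corner_def)
  qed
  then have "wfP (\<lambda>n m. step rules m n)"
    by (intro wfp_if_convertible_to_nat[where f = ?w]) auto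
  then show ?thesis by (simp add: conversep_iff[abs_def])
qed


section \<open>Overlapping rules\<close>

text \<open>
  Two rules whose rectangles have the same lower left corner. Thinness excludes a rectangle that is
  strictly longer than the other one in both directions; when each is longer in one direction, they
  are a row and a column.
\<close>

lemma joinable_lower:
  assumes r1: "inner x y x1 y1" and r2: "inner x y x2 y2" and le: "x1 \<le> x2"
  shows "joinable (step rules) (xv x y1 + xv x1 y + xv x2 y2) (xv x y2 + xv x2 y + xv x1 y1)"
proof -
  note less = inner_less[OF r1] inner_less[OF r2]
  consider "x1 = x2" "y1 = y2" | "x1 = x2" "y1 < y2" | "x1 = x2" "y2 < y1"
    | "x1 < x2" "y1 = y2" | "x1 < x2" "y1 < y2" | "x1 < x2" "y2 < y1"
    using le by linarith
  then show ?thesis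
  proof cases
    case 1
    then show ?thesis by (auto simp: joinable_def)
  next
    case 2
    have "inner x y1 x2 y2"
      using less 2 by (intro inner_mono[OF r2]) auto
    then have "step rules (xv x y1 + xv x1 y + xv x2 y2) (xv x y2 + xv x2 y + xv x1 y1)"
      using 2 by (intro step_rule[where t = "xv x1 y"]) (auto simp: ac_simps)
    then show ?thesis by (rule joinable_single_step)
  next
    case 3
    have "inner x y2 x1 y1"
      using less 3 by (intro inner_mono[OF r1]) auto
    then have "step rules (xv x y2 + xv x2 y + xv x1 y1) (xv x y1 + xv x1 y + xv x2 y2)"
      using 3 by (intro step_rule[where t = "xv x1 y"]) (auto simp: ac_simps)
    then show ?thesis by (intro joinable_sym[OF joinable_single_step])
  next
    case 4
    have "inner x1 y x2 y2"
      using less 4 by (intro inner_mono[OF r2]) auto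
    then have "step rules (xv x y1 + xv x1 y + xv x2 y2) (xv x y2 + xv x2 y + xv x1 y1)"
      using 4 by (intro step_rule[where t = "xv x y1"]) (auto simp: ac_simps)
    then show ?thesis by (rule joinable_single_step)
  next
    case 5
    with inner_thin[OF r2] less show ?thesis by auto
  next
    case 6
    have "inner x1 y x2 y2" "inner x y2 x1 y1"
      using less 6 inner_mono[OF r2, of x1 x2 y y2] inner_mono[OF r1, of x x1 y2 y1] by auto
    then show ?thesis
      by (rule joinable_two_steps[where s = "xv x y1" and t = "xv x2 y"]) (simp_all add: ac_simps)
  qed
qed

text \<open>The same for a common upper right corner.\<close>

lemma joinable_upper:
  assumes r1: "inner x1 y1 x y" and r2: "inner x2 y2 x y" and le: "x1 \<le> x2"
  shows "joinable (step rules) (xv x1 y + xv x y1 + xv x2 y2) (xv x2 y + xv x y2 + xv x1 y1)"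
proof -
  note less = inner_less[OF r1] inner_less[OF r2]
  consider "x1 = x2" "y1 = y2" | "x1 = x2" "y1 < y2" | "x1 = x2" "y2 < y1"
    | "x1 < x2" "y1 = y2" | "x1 < x2" "y1 < y2" | "x1 < x2" "y2 < y1"
    using le by linarith
  then show ?thesis
  proof cases
    case 1
    then show ?thesis by (auto simp: joinable_def)
  next
    case 2
    have "inner x1 y1 x y2"
      using less 2 by (intro inner_mono[OF r1]) auto
    then have "step rules (xv x2 y + xv x y2 + xv x1 y1) (xv x1 y + xv x y1 + xv x2 y2)"
      using 2 by (intro step_rule[where t = "xv x2 y"]) (auto simp: ac_simps)
    then show ?thesis by (intro joinable_sym[OF joinable_single_step])
  next
    case 3
    have "inner x2 y2 x y1"
      using less 3 by (intro inner_mono[OF r2]) auto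
    then have "step rules (xv x1 y + xv x y1 + xv x2 y2) (xv x2 y + xv x y2 + xv x1 y1)"
      using 3 by (intro step_rule[where t = "xv x1 y"]) (auto simp: ac_simps)
    then show ?thesis by (rule joinable_single_step)
  next
    case 4
    have "inner x1 y1 x2 y"
      using less 4 by (intro inner_mono[OF r1]) auto
    then have "step rules (xv x2 y + xv x y2 + xv x1 y1) (xv x1 y + xv x y1 + xv x2 y2)"
      using 4 by (intro step_rule[where t = "xv x y2"]) (auto simp: ac_simps)
    then show ?thesis by (intro joinable_sym[OF joinable_single_step])
  next
    case 5
    with inner_thin[OF r1] less show ?thesis by auto
  next
    case 6
    have "inner x2 y2 x y1" "inner x1 y1 x2 y"
      using less 6 inner_mono[OF r2, of x2 x y2 y1] inner_mono[OF r1, of x1 x2 y1 y] by auto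
    then show ?thesis
      by (rule joinable_two_steps[where s = "xv x1 y" and t = "xv x y2"]) (simp_all add: ac_simps)
  qed
qed

text \<open>
  Two rules such that the upper right corner of one rectangle is the lower left corner of the other;
  here the hypothesis on the shape is needed.
\<close>

lemma joinable_chain:
  assumes good: "obstruction_free Q" and r1: "inner x1 y1 x y" and r2: "inner x y x2 y2"
  shows "joinable (step rules) (xv x1 y + xv x y1 + xv x2 y2) (xv x y2 + xv x2 y + xv x1 y1)"
proof -
  note less = inner_less[OF r1] inner_less[OF r2]
  have LL: "Q (x - 1) (y - 1)"
    using less by (intro inner_cell[OF r1]) auto
  have UR: "Q x y"
    using less by (intro inner_cell[OF r2]) auto
  have no_gap: "\<not> (Q i j \<and> Q (i + 1) (j + 1) \<and> \<not> Q i (j + 1) \<and> \<not> Q (i + 1) j)"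
    and no_hor: "\<not> (Q i j \<and> Q (i + 1) j \<and> Q (i + 1) (j + 1) \<and> Q (i + 2) (j + 1))"
    and no_ver: "\<not> (Q i j \<and> Q i (j + 1) \<and> Q (i + 1) (j + 1) \<and> Q (i + 1) (j + 2))" for i j
    using good unfolding obstruction_free_def by blast+
  from no_gap[of "x - 1" "y - 1"] LL UR consider "Q (x - 1) y" | "Q x (y - 1)"
    by auto
  then show ?thesis
  proof cases
    case 1
    \<comment> \<open>Without staircases the first rectangle is a column and the second one a row, and the cell to
      the upper left of their common corner prolongs both.\<close>
    have "\<not> Q x (y + 1)" "\<not> Q (x - 2) (y - 1)"
      using no_ver[of "x - 1" "y - 1"] no_hor[of "x - 2" "y - 1"] LL 1 UR
      by (auto simp: algebra_simps)
    then have "\<not> y + 1 < y2" "\<not> x1 \<le> x - 2"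
      using inner_cell[OF r2, of x "y + 1"] inner_cell[OF r1, of "x - 2" "y - 1"] less by auto
    then have eq: "y2 = y + 1" "x1 = x - 1"
      using less by linarith+
    have "Q i y" if "x - 1 \<le> i" "i < x2" for i
      using that 1 less inner_cell[OF r2, of i y] by (cases "i = x - 1") auto
    then have "inner (x - 1) y x2 (y + 1)"
      using less by (intro inner_rowI) auto
    moreover have "Q (x - 1) j" if "y1 \<le> j" "j < y + 1" for j
      using that 1 less inner_cell[OF r1, of "x - 1" j] by (cases "j = y") auto
    then have "inner (x - 1) y1 x (y + 1)"
      using less inner_columnI[of y1 "y + 1" "x - 1"] by auto
    ultimately show ?thesis
      by (rule joinable_two_steps[where s = "xv x y1" and t = "xv x2 y"]) (simp_all add: eq ac_simps)
  next
    case 2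
    \<comment> \<open>Now the first rectangle is a row, the second one a column, and both are prolonged by the cell
      to the lower right.\<close>
    have "\<not> Q (x + 1) y" "\<not> Q (x - 1) (y - 2)"
      using no_hor[of "x - 1" "y - 1"] no_ver[of "x - 1" "y - 2"] LL 2 UR
      by (auto simp: algebra_simps)
    then have "\<not> x + 1 < x2" "\<not> y1 \<le> y - 2"
      using inner_cell[OF r2, of "x + 1" y] inner_cell[OF r1, of "x - 1" "y - 2"] less by auto
    then have eq: "x2 = x + 1" "y1 = y - 1"
      using less by linarith+
    have "Q x j" if "y - 1 \<le> j" "j < y2" for j
      using that 2 less inner_cell[OF r2, of x j] by (cases "j = y - 1") auto
    then have "inner x (y - 1) (x + 1) y2"
      using less by (intro inner_columnI) auto
    moreover have "Q i (y - 1)" if "x1 \<le> i" "i < x + 1" for i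
      using that 2 less inner_cell[OF r1, of i "y - 1"] by (cases "i = x") auto
    then have "inner x1 (y - 1) (x + 1) y"
      using less inner_rowI[of x1 "x + 1" "y - 1"] by auto
    ultimately show ?thesis
      by (rule joinable_two_steps[where s = "xv x1 y" and t = "xv x y2"]) (simp_all add: eq ac_simps)
  qed
qed

lemma step_locally_joinable:
  assumes good: "obstruction_free Q" and km: "step rules k m" and kn: "step rules k n"
  shows "joinable (step rules) m n"
proof -
  from km obtain x1 y1 x2 y2 t1 where r1: "inner x1 y1 x2 y2"
    and k1: "k = xv x1 y1 + xv x2 y2 + t1" and m: "m = xv x1 y2 + xv x2 y1 + t1"
    by (rule step_ruleE)
  from kn obtain x3 y3 x4 y4 t2 where r2: "inner x3 y3 x4 y4"
    and k2: "k = xv x3 y3 + xv x4 y4 + t2" and n: "n = xv x3 y4 + xv x4 y3 + t2"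
    by (rule step_ruleE)
  note less = inner_less[OF r1] inner_less[OF r2]
  note corners = inner_corners[OF r1] inner_corners[OF r2]
  have eq: "Poly_Mapping.single (X x1 y1) 1 + (xv x2 y2 + t1) =
      Poly_Mapping.single (X x3 y3) 1 + (xv x4 y4 + t2)"
    using k1 k2 by (simp add: xv_def ac_simps)
  from eq show ?thesis
  proof (cases rule: single_add_eqE)
    case 1
    then have lower: "x3 = x1" "y3 = y1"
      using corner_eq_iff[OF corners(1,5)] by auto
    from 1(2) show ?thesis unfolding xv_def
    proof (cases rule: single_add_eqE)
      case 1
      then have "x4 = x2" "y4 = y2"
        using corner_eq_iff[OF corners(2,6)] by auto
      with 1 lower show ?thesis by (auto simp: m n joinable_def)
    next
      case (2 t)
      have "joinable (step rules) (xv x1 y2 + xv x2 y1 + xv x4 y4) (xv x1 y4 + xv x4 y1 + xv x2 y2)"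
        using joinable_lower[OF r1 r2[unfolded lower]] joinable_lower[OF r2[unfolded lower] r1]
        by (metis joinable_sym linear)
      from joinable_step_add[OF this, of t] show ?thesis
        by (simp add: m n 2 lower ac_simps xv_fold)
    qed
  next
    case (2 r)
    note first = 2
    from 2(2) show ?thesis unfolding xv_def
    proof (cases rule: single_add_eqE)
      case 1
      then have w: "x3 = x2" "y3 = y2"
        using corner_eq_iff[OF corners(2,5)] by auto
      from first(3)[unfolded xv_def] show ?thesis
      proof (cases rule: single_add_eqE)
        case 1
        with corner_eq_iff[OF corners(6,1)] w less show ?thesis by auto
      next
        case (2 t)
        from joinable_step_add[OF joinable_chain[OF good r1 r2[unfolded w]], of t] show ?thesis
          by (simp add: m n 1 2 w ac_simps xv_fold)
      qed
    next
      case (2 w)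
      note t1 = 2(2) and r = 2(3)
      from first(3)[unfolded xv_def] show ?thesis
      proof (cases rule: single_add_eqE)
        case 1
        then have c: "x4 = x1" "y4 = y1"
          using corner_eq_iff[OF corners(6,1)] by auto
        from joinable_step_add[OF joinable_chain[OF good r2[unfolded c] r1], of w] show ?thesis
          by (intro joinable_sym[of _ n m]) (simp add: m n 1 t1 r c ac_simps xv_fold)
      next
        case (2 w')
        note t2 = 2(2)
        from 2(3)[unfolded r] show ?thesis
        proof (cases rule: single_add_eqE)
          case 1
          then have c: "x4 = x2" "y4 = y2"
            using corner_eq_iff[OF corners(2,6)] by auto
          have "joinable (step rules) (xv x1 y2 + xv x2 y1 + xv x3 y3) (xv x3 y2 + xv x2 y3 + xv x1 y1)"
            using joinable_upper[OF r1 r2[unfolded c]] joinable_upper[OF r2[unfolded c] r1]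
            by (metis joinable_sym linear)
          from joinable_step_add[OF this, of w] show ?thesis
            by (simp add: m n 1 t1 t2 c ac_simps xv_fold)
        next
          case (2 v)
          \<comment> \<open>The two rules have no variable in common and commute.\<close>
          show ?thesis
            by (rule joinable_two_steps[OF r2 r1, where s = "xv x1 y2 + xv x2 y1 + v"
                  and t = "xv x3 y4 + xv x4 y3 + v"])
              (simp_all add: m n t1 t2 2 ac_simps xv_fold)
        qed
      qed
    qed
  qed
qed

lemma step_confluent:
  assumes "obstruction_free Q" "(step rules)\<^sup>*\<^sup>* k m" "(step rules)\<^sup>*\<^sup>* k n"
  shows "joinable (step rules) m n"
  using joinable_if_locally_joinable[OF wf_step step_locally_joinable[OF assms(1)] assms(2,3)] .


section \<open>Obstructions\<close>

text \<open>A product of three variables is a normal form if no two of the three span a full rectangle as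
  lower left and upper right corner.\<close>

lemma irreducible_cubic:
  assumes "corner a a'" "corner b b'" "corner c c'"
    and "\<And>x1 y1 x2 y2. inner x1 y1 x2 y2 \<Longrightarrow> (x1, y1) \<in> {(a, a'), (b, b'), (c, c')} \<Longrightarrow>
      (x2, y2) \<in> {(a, a'), (b, b'), (c, c')} \<Longrightarrow> False"
  shows "\<not> step rules (xv a a' + xv b b' + xv c c') l"
proof
  assume "step rules (xv a a' + xv b b' + xv c c') l"
  then obtain x1 y1 x2 y2 t where r: "inner x1 y1 x2 y2"
    and eq: "xv a a' + xv b b' + xv c c' = xv x1 y1 + xv x2 y2 + t"
    by (rule step_ruleE)
  have keys: "Poly_Mapping.keys (xv x1 y1 + xv x2 y2 + t) = {X a a', X b b', X c c'}"
    unfolding eq[symmetric] by (auto simp: xv_def keys_add_nat)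
  then have "X x1 y1 \<in> {X a a', X b b', X c c'}" "X x2 y2 \<in> {X a a', X b b', X c c'}"
    by (auto simp: xv_def keys_add_nat)
  then have "(x1, y1) \<in> {(a, a'), (b, b'), (c, c')}" "(x2, y2) \<in> {(a, a'), (b, b'), (c, c')}"
    using inner_corners(1,2)[OF r] assms(1-3) by (auto simp: corner_eq_iff)
  with assms(4) r show False by blast
qed

text \<open>
  If two full rectangles meet at a corner and none of the four rectangles that prolong one of them
  along a side of the other is full, then the two reducts \<open>m\<close>, \<open>n\<close> of the product \<open>k\<close> of the three
  corners are different normal forms.
\<close>

lemma obstruction:
  assumes r1: "inner x1 y1 x y" and r2: "inner x y x2 y2"
    and "\<not> inner x1 y x2 y2" "\<not> inner x y1 x2 y2" "\<not> inner x1 y1 x y2" "\<not> inner x1 y1 x2 y"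
  defines "k \<equiv> xv x1 y1 + xv x y + xv x2 y2"
    and "m \<equiv> xv x1 y + xv x y1 + xv x2 y2" and "n \<equiv> xv x1 y1 + xv x y2 + xv x2 y"
  shows "step rules k m" "step rules k n" "m \<noteq> n" "\<not> step rules m l" "\<not> step rules n l"
proof -
  note less = inner_less[OF r1] inner_less[OF r2]
  note corners = inner_corners[OF r1] inner_corners[OF r2]
  show "step rules k m"
    by (rule step_rule[OF r1, where t = "xv x2 y2"]) (simp_all add: k_def m_def)
  show "step rules k n"
    by (rule step_rule[OF r2, where t = "xv x1 y1"]) (simp_all add: k_def n_def ac_simps)
  show "\<not> step rules m l" unfolding m_def
    using corners assms(3,4) less by (intro irreducible_cubic) (auto dest: inner_less)
  show "\<not> step rules n l" unfolding n_def
    using corners assms(5,6) less by (intro irreducible_cubic) (auto dest: inner_less)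
  have "X x1 y1 \<in> Poly_Mapping.keys n" "X x1 y1 \<notin> Poly_Mapping.keys m"
    using corners less by (auto simp: n_def m_def xv_def keys_add_nat corner_eq_iff)
  then show "m \<noteq> n" by auto
qed

text \<open>
  Each excluded shape contains such a pair of rectangles, whose first member is the cell \<open>(i, j)\<close>. For
  the staircases, the second one consists of the last two cells, and thinness supplies the two
  missing cells.
\<close>

lemma obstruction_exists:
  assumes "\<not> obstruction_free Q"
  shows "\<exists>x1 y1 x y x2 y2. inner x1 y1 x y \<and> inner x y x2 y2 \<and> \<not> inner x1 y x2 y2 \<and>
    \<not> inner x y1 x2 y2 \<and> \<not> inner x1 y1 x y2 \<and> \<not> inner x1 y1 x2 y"
proof -
  have cell: "inner i j i' j'" if "Q i j" "i' = i + 1" "j' = j + 1" for i j i' j'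
  proof -
    have "Q k j" if "i \<le> k" "k < i + 1" for k
      using that \<open>Q i j\<close> by (cases "k = i") auto
    then show ?thesis
      using inner_rowI[of i "i + 1" j] that by simp
  qed
  have no_inner: "\<not> inner x1 y1 x2 y2" if "\<not> Q i j" "x1 \<le> i" "i < x2" "y1 \<le> j" "j < y2" for i j x1 y1 x2 y2
    using that inner_cell by blast
  from assms consider (gap) i j where "Q i j" "Q (i + 1) (j + 1)" "\<not> Q i (j + 1)" "\<not> Q (i + 1) j"
    | (hor) i j where "Q i j" "Q (i + 1) j" "Q (i + 1) (j + 1)" "Q (i + 2) (j + 1)"
    | (ver) i j where "Q i j" "Q i (j + 1)" "Q (i + 1) (j + 1)" "Q (i + 1) (j + 2)"
    unfolding obstruction_free_def by blast
  then show ?thesis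
  proof cases
    case gap
    have "inner i j (i + 1) (j + 1)" "inner (i + 1) (j + 1) (i + 2) (j + 2)"
      using cell[OF gap(1)] cell[OF gap(2), of "i + 2" "j + 2"] by simp_all
    moreover have "\<not> inner i (j + 1) (i + 2) (j + 2)" "\<not> inner i j (i + 1) (j + 2)"
      using no_inner[OF gap(3), of i "i + 2" "j + 1" "j + 2"] no_inner[OF gap(3), of i "i + 1" j "j + 2"] by auto
    moreover have "\<not> inner (i + 1) j (i + 2) (j + 2)" "\<not> inner i j (i + 2) (j + 1)"
      using no_inner[OF gap(4), of "i + 1" "i + 2" j "j + 2"] no_inner[OF gap(4), of i "i + 2" j "j + 1"] by auto
    ultimately show ?thesis by blast
  next
    case hor
    have gaps: "\<not> Q i (j + 1)" "\<not> Q (i + 2) j"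
      using hor thin[of i j] thin[of "i + 1" j] by (auto simp: algebra_simps)
    have "inner (i + 1) (j + 1) (i + 3) (j + 2)"
    proof -
      have "Q k (j + 1)" if "i + 1 \<le> k" "k < i + 3" for k
      proof -
        have "k = i + 1 \<or> k = i + 2"
          using that by linarith
        with hor show ?thesis by blast
      qed
      then show ?thesis
        using inner_rowI[of "i + 1" "i + 3" "j + 1"] by (simp add: add.commute)
    qed
    moreover have "inner i j (i + 1) (j + 1)"
      using cell hor by simp
    moreover have "\<not> inner i (j + 1) (i + 3) (j + 2)" "\<not> inner i j (i + 1) (j + 2)"
      using no_inner[OF gaps(1), of i "i + 3" "j + 1" "j + 2"]
        no_inner[OF gaps(1), of i "i + 1" j "j + 2"] by auto
    moreover have "\<not> inner (i + 1) j (i + 3) (j + 2)" "\<not> inner i j (i + 3) (j + 1)"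
      using no_inner[OF gaps(2), of "i + 1" "i + 3" j "j + 2"]
        no_inner[OF gaps(2), of i "i + 3" j "j + 1"] by auto
    ultimately show ?thesis by blast
  next
    case ver
    have gaps: "\<not> Q i (j + 2)" "\<not> Q (i + 1) j"
      using ver thin[of i j] thin[of i "j + 1"] by (auto simp: algebra_simps)
    have "inner (i + 1) (j + 1) (i + 2) (j + 3)"
    proof -
      have "Q (i + 1) k" if "j + 1 \<le> k" "k < j + 3" for k
      proof -
        have "k = j + 1 \<or> k = j + 2"
          using that by linarith
        with ver show ?thesis by blast
      qed
      then show ?thesis
        using inner_columnI[of "j + 1" "j + 3" "i + 1"] by (simp add: add.commute)
    qed
    moreover have "inner i j (i + 1) (j + 1)"
      using cell ver by simp
    moreover have "\<not> inner i (j + 1) (i + 2) (j + 3)" "\<not> inner i j (i + 1) (j + 3)"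
      using no_inner[OF gaps(1), of i "i + 2" "j + 1" "j + 3"]
        no_inner[OF gaps(1), of i "i + 1" j "j + 3"] by auto
    moreover have "\<not> inner (i + 1) j (i + 2) (j + 3)" "\<not> inner i j (i + 2) (j + 1)"
      using no_inner[OF gaps(2), of "i + 1" "i + 2" j "j + 3"]
        no_inner[OF gaps(2), of i "i + 2" j "j + 1"] by auto
    ultimately show ?thesis by blast
  qed
qed

text \<open>The left hand side of a rule divides no monomial of another one: this is why the minors are
  always reduced, whether or not they form a Groebner basis.\<close>

lemma rules_reduced:
  assumes "(u, v) \<in> rules" "(u', v') \<in> rules"
  shows "mon_dvd u' u \<Longrightarrow> (u', v') = (u, v)" "\<not> mon_dvd u' v"
proof -
  from assms obtain x1 y1 x2 y2 x3 y3 x4 y4 where r1: "inner x1 y1 x2 y2" and r2: "inner x3 y3 x4 y4"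
    and uv: "u = xv x1 y1 + xv x2 y2" "v = xv x1 y2 + xv x2 y1"
      "u' = xv x3 y3 + xv x4 y4" "v' = xv x3 y4 + xv x4 y3"
    unfolding rules_def by blast
  note less = inner_less[OF r1] inner_less[OF r2]
  note corners = inner_corners[OF r1] inner_corners[OF r2]
  show "(u', v') = (u, v)" if "mon_dvd u' u"
  proof -
    from that have "Poly_Mapping.keys u' \<subseteq> Poly_Mapping.keys u"
      by (auto simp: mon_dvd_def keys_add_nat)
    then have "(x3, y3) \<in> {(x1, y1), (x2, y2)}" "(x4, y4) \<in> {(x1, y1), (x2, y2)}"
      using corners by (auto simp: uv xv_def keys_add_nat corner_eq_iff)
    with less show ?thesis by (auto simp: uv)
  qed
  show "\<not> mon_dvd u' v"
  proof
    assume "mon_dvd u' v"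
    then have "Poly_Mapping.keys u' \<subseteq> Poly_Mapping.keys v"
      by (auto simp: mon_dvd_def keys_add_nat)
    then have "(x3, y3) \<in> {(x1, y2), (x2, y1)}" "(x4, y4) \<in> {(x1, y2), (x2, y1)}"
      using corners by (auto simp: uv xv_def keys_add_nat corner_eq_iff)
    with less show False by auto
  qed
qed

theorem reduced_groebner_basis_iff:
  assumes "binomial_rules ord V rules"
  shows "reduced_groebner_basis V ord (Idl\<^bsub>poly_ring V\<^esub> (binomials rules))
      (binomials rules :: ('v, 'k::field) mpoly set) \<longleftrightarrow> obstruction_free Q"
proof -
  interpret binomial_rules ord V rules by fact
  let ?B = "binomials rules :: ('v, 'k) mpoly set"
  have "groebner_basis V ord (Idl\<^bsub>poly_ring V\<^esub> ?B) ?B \<longleftrightarrow> obstruction_free Q"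
  proof
    assume gb: "groebner_basis V ord (Idl\<^bsub>poly_ring V\<^esub> ?B) ?B"
    show "obstruction_free Q"
    proof (rule ccontr)
      assume "\<not> obstruction_free Q"
      then obtain x1 y1 x y x2 y2 where r: "inner x1 y1 x y" "inner x y x2 y2"
        and "\<not> inner x1 y x2 y2" "\<not> inner x y1 x2 y2" "\<not> inner x1 y1 x y2" "\<not> inner x1 y1 x2 y"
        using obstruction_exists by blast
      note obs = obstruction[OF this]
      have "(xv x1 y1 + xv x y, xv x1 y + xv x y1) \<in> rules" "(xv x y + xv x2 y2, xv x y2 + xv x2 y) \<in> rules"
        using r unfolding rules_def by blast+
      then have "Poly_Mapping.keys (xv x1 y1 + xv x y + xv x2 y2) \<subseteq> V"
        using rule_vars by (fastforce simp: keys_add_nat)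
      from groebner_basis_reducts[OF gb this obs(1-3)] obs(4,5) show False
        by blast
    qed
  next
    assume "obstruction_free Q"
    then show "groebner_basis V ord (Idl\<^bsub>poly_ring V\<^esub> ?B) ?B"
      using step_confluent groebner_basis_if_confluent by blast
  qed
  moreover have "\<not> mon_dvd (lead_mon ord h) m"
    if "g \<in> ?B" "h \<in> ?B - {g}" "m \<in> Poly_Mapping.keys g" for g h m
  proof -
    from that(1) obtain u v where uv: "(u, v) \<in> rules"
      and g: "g = Poly_Mapping.single u 1 - Poly_Mapping.single v 1"
      unfolding binomials_def by fast
    from that(2) obtain u' v' where uv': "(u', v') \<in> rules"
      and h: "h = Poly_Mapping.single u' 1 - Poly_Mapping.single v' 1"
      unfolding binomials_def by fast
    have "(u', v') \<noteq> (u, v)"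
      using that(2) by (auto simp: g h)
    moreover have "m \<in> {u, v}" "lead_mon ord h = u'"
      using that(3) by (simp_all add: g h keys_binomial[OF uv] lead_mon_binomial[OF uv'])
    ultimately show ?thesis
      using rules_reduced[OF uv uv'] by auto
  qed
  moreover have "lead_coef ord g = 1" if "g \<in> ?B" for g
    using that by (auto simp: binomials_def lead_coef_binomial)
  ultimately show ?thesis
    unfolding reduced_groebner_basis_def by blast
qed

end


section \<open>Cells, intervals and patterns in the grid\<close>

lemma cell_eq: "cell (p, q) = {(p, q), (p + 1, q), (p, q + 1), (p + 1, q + 1)}"
proof -
  have "m = k \<or> m = k + 1" if "k \<le> m" "m \<le> k + 1" for k m :: nat
    using that by linarith
  then show ?thesis
    unfolding cell_def by (fastforce simp: less_eq_prod_def)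
qed

lemma cell_subset_iff: "cell (p, q) \<subseteq> {a..b} \<longleftrightarrow> fst a \<le> p \<and> p < fst b \<and> snd a \<le> q \<and> q < snd b"
  by (auto simp: cell_eq less_eq_prod_def)

lemma cell_inject [simp]: "cell a = cell b \<longleftrightarrow> a = b"
proof
  assume "cell a = cell b"
  moreover have "cell a \<subseteq> {a..a + (1, 1)}" "cell b \<subseteq> {b..b + (1, 1)}"
    by (auto simp: cell_def)
  ultimately have "cell (fst a, snd a) \<subseteq> {b..b + (1, 1)}" "cell (fst b, snd b) \<subseteq> {a..a + (1, 1)}"
    by auto
  then show "a = b"
    unfolding cell_subset_iff by (auto simp: prod_eq_iff)
qed simp

lemma inner_interval_iff:
  "inner_interval P a b \<longleftrightarrow> fst a < fst b \<and> snd a < snd b \<and>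
    (\<forall>p q. fst a \<le> p \<and> p < fst b \<and> snd a \<le> q \<and> q < snd b \<longrightarrow> cell (p, q) \<in> P)"
proof -
  have "(\<forall>C\<in>range cell. C \<subseteq> {a..b} \<longrightarrow> C \<in> P) \<longleftrightarrow> (\<forall>p q. cell (p, q) \<subseteq> {a..b} \<longrightarrow> cell (p, q) \<in> P)"
    by auto
  then show ?thesis
    unfolding inner_interval_def proper_interval_def cell_subset_iff by simp
qed

lemma inner_interval_vertices:
  assumes "inner_interval P (x1, y1) (x2, y2)"
  shows "{(x1, y1), (x2, y2), (x1, y2), (x2, y1)} \<subseteq> vertices P"
proof -
  obtain p q where "x2 = p + 1" "y2 = q + 1" "x1 \<le> p" "y1 \<le> q"
    using assms by (metis Suc_eq_plus1 fst_conv inner_interval_iff less_Suc_eq_le not0_implies_Suc not_less0 snd_conv)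
  with assms have "cell (x1, y1) \<in> P" "cell (p, q) \<in> P" "cell (x1, q) \<in> P" "cell (p, y1) \<in> P"
    by (auto simp: inner_interval_iff)
  moreover have "(x1, y1) \<in> cell (x1, y1)" "(x2, y2) \<in> cell (p, q)" "(x1, y2) \<in> cell (x1, q)"
      "(x2, y1) \<in> cell (p, y1)"
    by (simp_all add: cell_eq \<open>x2 = _\<close> \<open>y2 = _\<close>)
  ultimately show ?thesis
    unfolding vertices_def by blast
qed

lemma finite_vertices: "polyomino P \<Longrightarrow> finite (vertices P)"
  unfolding vertices_def by (rule finite_Union) (auto simp: polyomino_def cell_eq dest!: subsetD)

text \<open>The cells with lower left corners \<open>a\<close> and \<open>b\<close> share an edge.\<close>

definition adjacent :: "point \<Rightarrow> point \<Rightarrow> bool" where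
  "adjacent a b \<longleftrightarrow> b = a + (1, 0) \<or> b = a + (0, 1) \<or> a = b + (1, 0) \<or> a = b + (0, 1)"

lemma adjacent_sym: "adjacent a b \<Longrightarrow> adjacent b a"
  by (auto simp: adjacent_def)

lemma cell_Int:
  "cell (p, q) \<inter> cell (p + 1, q) = {(p + 1, q), (p + 1, q + 1)}"
  "cell (p, q) \<inter> cell (p, q + 1) = {(p, q + 1), (p + 1, q + 1)}"
  by (auto simp: cell_eq)

lemma adjacent_edge:
  assumes "adjacent a b"
  shows "is_edge_of (cell a \<inter> cell b) (cell a)"
proof -
  obtain p q r s where ab: "a = (p, q)" "b = (r, s)"
    by (meson surj_pair)
  consider "r = p + 1" "s = q" | "r = p" "s = q + 1" | "p = r + 1" "s = q" | "p = r" "q = s + 1"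
    using assms unfolding adjacent_def ab by force
  then have "cell a \<inter> cell b \<in> {{a, a + (1, 0)}, {a, a + (0, 1)}, {a + (1, 0), a + (1, 1)}, {a + (0, 1), a + (1, 1)}}"
  proof cases
    case 1
    have "cell a \<inter> cell b = {a + (1, 0), a + (1, 1)}"
      using cell_Int(1)[of p q] 1 by (simp add: ab)
    then show ?thesis by blast
  next
    case 2
    have "cell a \<inter> cell b = {a + (0, 1), a + (1, 1)}"
      using cell_Int(2)[of p q] 2 by (simp add: ab)
    then show ?thesis by blast
  next
    case 3
    have "cell a \<inter> cell b = {a, a + (0, 1)}"
      using cell_Int(1)[of r s] 3 by (simp add: ab Int_commute)
    then show ?thesis by blast
  next
    case 4
    have "cell a \<inter> cell b = {a, a + (1, 0)}"
      using cell_Int(2)[of r s] 4 by (simp add: ab Int_commute)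
    then show ?thesis by blast
  qed
  then show ?thesis
    unfolding is_edge_of_def by blast
qed

lemma polyomino_path4:
  assumes "adjacent a b" "adjacent b c" "adjacent c d"
  shows "polyomino {cell a, cell b, cell c, cell d}"
proof -
  let ?P = "{cell a, cell b, cell c, cell d}"
  let ?r = "\<lambda>C D. C \<in> ?P \<and> D \<in> ?P \<and> is_edge_of (C \<inter> D) C"
  have path: "\<exists>Cs. Cs \<noteq> [] \<and> set Cs \<subseteq> ?P \<and> hd Cs = C \<and> last Cs = D \<and>
      (\<forall>t. Suc t < length Cs \<longrightarrow> is_edge_of (Cs ! t \<inter> Cs ! Suc t) (Cs ! t))"
    if "?r\<^sup>*\<^sup>* C D" "D \<in> ?P" for C D
    using that
  proof (induction rule: converse_rtranclp_induct)
    case base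
    then show ?case by (intro exI[of _ "[D]"]) auto
  next
    case (step B C)
    then obtain Cs where Cs: "Cs \<noteq> []" "set Cs \<subseteq> ?P" "hd Cs = C" "last Cs = D"
      "\<forall>t. Suc t < length Cs \<longrightarrow> is_edge_of (Cs ! t \<inter> Cs ! Suc t) (Cs ! t)"
      by blast
    have "is_edge_of ((B # Cs) ! t \<inter> (B # Cs) ! Suc t) ((B # Cs) ! t)" if "Suc t < length (B # Cs)" for t
      using that Cs step.hyps(1) by (cases t) (auto simp: hd_conv_nth)
    then show ?case
      using Cs step.hyps(1) by (intro exI[of _ "B # Cs"]) auto
  qed
  have "?r (cell a) (cell b)" "?r (cell b) (cell a)" "?r (cell b) (cell c)" "?r (cell c) (cell b)"
    "?r (cell c) (cell d)" "?r (cell d) (cell c)"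
    using assms by (auto intro!: adjacent_edge dest: adjacent_sym)
  note r = this[THEN r_into_rtranclp[of ?r]]
  have "?r\<^sup>*\<^sup>* (cell b) D \<and> ?r\<^sup>*\<^sup>* D (cell b)" if "D \<in> ?P" for D
    using that r rtranclp_trans[of ?r] by blast
  then have "?r\<^sup>*\<^sup>* C D" if "C \<in> ?P" "D \<in> ?P" for C D
    using that by (meson rtranclp_trans)
  with path have "\<exists>Cs. Cs \<noteq> [] \<and> set Cs \<subseteq> ?P \<and> hd Cs = C \<and> last Cs = D \<and>
      (\<forall>t. Suc t < length Cs \<longrightarrow> is_edge_of (Cs ! t \<inter> Cs ! Suc t) (Cs ! t))"
    if "C \<in> ?P" "D \<in> ?P" for C D
    using that by meson
  moreover have "finite ?P" "?P \<subseteq> range cell"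
    by auto
  ultimately show ?thesis
    unfolding polyomino_def by meson
qed

lemma translate_cell: "(+) v ` cell a = cell (v + a)"
  by (cases v; cases a) (auto simp: cell_eq)

text \<open>
  Being a subpolyomino includes being a polyomino; for a path of four cells that part is automatic.
\<close>

lemma contains_translate_path4:
  assumes "adjacent a b" "adjacent b c" "adjacent c d"
  shows "contains_translate_of P {cell a, cell b, cell c, cell d} \<longleftrightarrow>
    (\<exists>v. cell (v + a) \<in> P \<and> cell (v + b) \<in> P \<and> cell (v + c) \<in> P \<and> cell (v + d) \<in> P)"
proof -
  have "polyomino {cell (v + a), cell (v + b), cell (v + c), cell (v + d)}" for v
    using assms by (intro polyomino_path4) (auto simp: adjacent_def add.assoc)
  then show ?thesis
    by (simp add: contains_translate_of_def subpolyomino_def translate_def translate_cell)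
qed

lemma square2x2_iff: "contains_translate_of P square2x2 \<longleftrightarrow>
    (\<exists>p q. cell (p, q) \<in> P \<and> cell (p + 1, q) \<in> P \<and> cell (p, q + 1) \<in> P \<and> cell (p + 1, q + 1) \<in> P)"
proof -
  have "square2x2 = {cell (0, 0), cell (1, 0), cell (1, 1), cell (0, 1)}"
    by (auto simp: square2x2_def)
  then show ?thesis
    using contains_translate_path4[of "(0, 0)" "(1, 0)" "(1, 1)" "(0, 1)" P]
    by (simp add: adjacent_def split_paired_Ex conj_ac)
qed

lemma T_i_iff: "contains_translate_of P T_i \<longleftrightarrow>
    (\<exists>p q. cell (p, q) \<in> P \<and> cell (p + 1, q) \<in> P \<and> cell (p + 1, q + 1) \<in> P \<and> cell (p + 2, q + 1) \<in> P)"
  using contains_translate_path4[of "(0, 0)" "(1, 0)" "(1, 1)" "(2, 1)" P]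
  by (simp add: T_i_def adjacent_def split_paired_Ex)

lemma T_ii_iff: "contains_translate_of P T_ii \<longleftrightarrow>
    (\<exists>p q. cell (p, q) \<in> P \<and> cell (p, q + 1) \<in> P \<and> cell (p + 1, q + 1) \<in> P \<and> cell (p + 1, q + 2) \<in> P)"
  using contains_translate_path4[of "(0, 0)" "(0, 1)" "(1, 1)" "(1, 2)" P]
  by (simp add: T_ii_def adjacent_def split_paired_Ex)

lemma T_iii_iff: "contains_translate_of P T_iii \<longleftrightarrow>
    (\<exists>p q. cell (p, q + 1) \<in> P \<and> cell (p + 1, q + 1) \<in> P \<and> cell (p + 1, q) \<in> P \<and> cell (p + 2, q) \<in> P)"
  using contains_translate_path4[of "(0, 1)" "(1, 1)" "(1, 0)" "(2, 0)" P]
  by (simp add: T_iii_def adjacent_def split_paired_Ex)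

lemma T_iv_iff: "contains_translate_of P T_iv \<longleftrightarrow>
    (\<exists>p q. cell (p, q + 2) \<in> P \<and> cell (p, q + 1) \<in> P \<and> cell (p + 1, q + 1) \<in> P \<and> cell (p + 1, q) \<in> P)"
proof -
  have "T_iv = {cell (0, 2), cell (0, 1), cell (1, 1), cell (1, 0)}"
    by (auto simp: T_iv_def)
  then show ?thesis
    using contains_translate_path4[of "(0, 2)" "(0, 1)" "(1, 1)" "(1, 0)" P]
    by (simp add: adjacent_def split_paired_Ex)
qed

lemma cells_around:
  "cell_lower_left (p + 1, q + 1) C \<longleftrightarrow> C = cell (p, q)"
  "cell_lower_right (p + 1, q + 1) C \<longleftrightarrow> C = cell (p + 1, q)"
  "cell_upper_left (p + 1, q + 1) C \<longleftrightarrow> C = cell (p, q + 1)"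
  "cell_upper_right (p + 1, q + 1) C \<longleftrightarrow> C = cell (p + 1, q + 1)"
  by (auto simp: cell_lower_left_def cell_lower_right_def cell_upper_left_def cell_upper_right_def prod_eq_iff)

lemma cell_lower_left_vertex: "cell_lower_left w C \<Longrightarrow> \<exists>p q. w = (p + 1, q + 1)"
  by (auto simp: cell_lower_left_def prod_eq_iff)

lemma diagonal_gap_iff:
  "(\<exists>w C D E F. cell_upper_left w C \<and> cell_lower_right w D \<and>
      cell_lower_left w E \<and> cell_upper_right w F \<and> C \<notin> P \<and> D \<notin> P \<and> E \<in> P \<and> F \<in> P) \<longleftrightarrow>
    (\<exists>p q. cell (p, q) \<in> P \<and> cell (p + 1, q + 1) \<in> P \<and> cell (p, q + 1) \<notin> P \<and> cell (p + 1, q) \<notin> P)"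
    (is "?L \<longleftrightarrow> ?R")
proof
  assume ?L
  then obtain w C D E F where w: "cell_upper_left w C" "cell_lower_right w D"
      "cell_lower_left w E" "cell_upper_right w F" and P: "C \<notin> P" "D \<notin> P" "E \<in> P" "F \<in> P"
    by (elim exE conjE)
  from w(3) obtain p q where w_eq: "w = (p + 1, q + 1)"
    using cell_lower_left_vertex by blast
  from w P show ?R
    unfolding w_eq cells_around by blast
next
  assume ?R
  then obtain p q where "cell (p, q) \<in> P" "cell (p + 1, q + 1) \<in> P" "cell (p, q + 1) \<notin> P" "cell (p + 1, q) \<notin> P"
    by blast
  then have "\<exists>C D E F. cell_upper_left (p + 1, q + 1) C \<and> cell_lower_right (p + 1, q + 1) D \<and>
      cell_lower_left (p + 1, q + 1) E \<and> cell_upper_right (p + 1, q + 1) F \<and> C \<notin> P \<and> D \<notin> P \<and> E \<in> P \<and> F \<in> P"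
    unfolding cells_around by blast
  then show ?L by blast
qed

lemma antidiagonal_gap_iff:
  "(\<exists>w C D E F. cell_lower_left w C \<and> cell_upper_right w D \<and>
      cell_upper_left w E \<and> cell_lower_right w F \<and> C \<notin> P \<and> D \<notin> P \<and> E \<in> P \<and> F \<in> P) \<longleftrightarrow>
    (\<exists>p q. cell (p, q + 1) \<in> P \<and> cell (p + 1, q) \<in> P \<and> cell (p, q) \<notin> P \<and> cell (p + 1, q + 1) \<notin> P)"
    (is "?L \<longleftrightarrow> ?R")
proof
  assume ?L
  then obtain w C D E F where w: "cell_lower_left w C" "cell_upper_right w D"
      "cell_upper_left w E" "cell_lower_right w F" and P: "C \<notin> P" "D \<notin> P" "E \<in> P" "F \<in> P"
    by (elim exE conjE)
  from w(1) obtain p q where w_eq: "w = (p + 1, q + 1)"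
    using cell_lower_left_vertex by blast
  from w P show ?R
    unfolding w_eq cells_around by blast
next
  assume ?R
  then obtain p q where "cell (p, q + 1) \<in> P" "cell (p + 1, q) \<in> P" "cell (p, q) \<notin> P" "cell (p + 1, q + 1) \<notin> P"
    by blast
  then have "\<exists>C D E F. cell_lower_left (p + 1, q + 1) C \<and> cell_upper_right (p + 1, q + 1) D \<and>
      cell_upper_left (p + 1, q + 1) E \<and> cell_lower_right (p + 1, q + 1) F \<and> C \<notin> P \<and> D \<notin> P \<and> E \<in> P \<and> F \<in> P"
    unfolding cells_around by blast
  then show ?L by blast
qed


section \<open>A polyomino and its mirror image as grids\<close>

text \<open>
  For \<open>s = True\<close> the first coordinate is negated; the cell with lower left corner \<open>(p, q)\<close> then gets
  the lower left corner \<open>(- p - 1, q)\<close>, and the two diagonals of a rectangle are exchanged.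
\<close>

definition grid_cell :: "bool \<Rightarrow> point set set \<Rightarrow> int \<Rightarrow> int \<Rightarrow> bool" where
  "grid_cell s P i j \<longleftrightarrow> (\<exists>p q. cell (p, q) \<in> P \<and> i = (if s then - int p - 1 else int p) \<and> j = int q)"

text \<open>The point whose integer coordinates are \<open>(x, y)\<close>; meaningful for \<open>0 \<le> y\<close> and \<open>x\<close> of the right
  sign, which holds at the corners of cells.\<close>

definition grid_point :: "bool \<Rightarrow> int \<Rightarrow> int \<Rightarrow> point" where
  "grid_point s x y = (nat (if s then - x else x), nat y)"

lemma grid_cell_False [simp]: "grid_cell False P (int p) (int q) \<longleftrightarrow> cell (p, q) \<in> P"
  by (auto simp: grid_cell_def)

lemma grid_cell_True [simp]: "grid_cell True P (- int p - 1) (int q) \<longleftrightarrow> cell (p, q) \<in> P"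
  by (auto simp: grid_cell_def)

lemma cell_grid_polyomino:
  assumes "Defs.thin P"
  shows "cell_grid (grid_point s) (\<lambda>v. if s then - int (fst v) else int (fst v)) (\<lambda>v. int (snd v)) (grid_cell s P)"
proof
  fix i j x y :: int
  assume "grid_cell s P i j" "x \<in> {i, i + 1}" "y \<in> {j, j + 1}"
  then show "(if s then - int (fst (grid_point s x y)) else int (fst (grid_point s x y))) = x \<and>
      int (snd (grid_point s x y)) = y"
    by (cases s) (auto simp: grid_cell_def grid_point_def)
next
  fix i j
  show "\<not> (grid_cell s P i j \<and> grid_cell s P (i + 1) j \<and> grid_cell s P i (j + 1) \<and> grid_cell s P (i + 1) (j + 1))"
  proof
    assume sq: "grid_cell s P i j \<and> grid_cell s P (i + 1) j \<and> grid_cell s P i (j + 1) \<and> grid_cell s P (i + 1) (j + 1)"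
    show False
    proof (cases s)
      case False
      have "grid_cell False P i j"
        using sq False by simp
      then obtain p q where ij: "i = int p" "j = int q"
        by (auto simp: grid_cell_def)
      have "i + 1 = int (p + 1)" "j + 1 = int (q + 1)"
        by (simp_all add: ij)
      then have "cell (p, q) \<in> P" "cell (p + 1, q) \<in> P" "cell (p, q + 1) \<in> P" "cell (p + 1, q + 1) \<in> P"
        using sq False ij grid_cell_False by metis+
      with assms show False
        unfolding thin_def square2x2_iff by blast
    next
      case True
      have "grid_cell True P (i + 1) j"
        using sq True by simp
      then obtain p q where ij: "i + 1 = - int p - 1" "j = int q"
        by (auto simp: grid_cell_def)
      then have "i = - int (p + 1) - 1" "j + 1 = int (q + 1)"
        by simp_all
      then have "cell (p, q) \<in> P" "cell (p + 1, q) \<in> P" "cell (p, q + 1) \<in> P" "cell (p + 1, q + 1) \<in> P"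
        using sq True ij grid_cell_True by metis+
      with assms show False
        unfolding thin_def square2x2_iff by blast
    qed
  qed
qed

lemma obstruction_free_grid_cell:
  "obstruction_free (grid_cell False P) \<longleftrightarrow>
    \<not> (\<exists>w C D E F. cell_upper_left w C \<and> cell_lower_right w D \<and>
      cell_lower_left w E \<and> cell_upper_right w F \<and> C \<notin> P \<and> D \<notin> P \<and> E \<in> P \<and> F \<in> P) \<and>
    \<not> contains_translate_of P T_i \<and> \<not> contains_translate_of P T_ii"
proof -
  have 0: "i = int (nat i)" "j = int (nat j)" if "grid_cell False P i j" for i j
    using that by (auto simp: grid_cell_def)
  have 1: "int p + 1 = int (p + 1)" "int p + 2 = int (p + 2)" for p
    by auto
  have ex: "(\<exists>i j. grid_cell False P i j \<and> A i j) \<longleftrightarrow> (\<exists>p q. cell (p, q) \<in> P \<and> A (int p) (int q))" for A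
    using 0 by (metis grid_cell_False)
  show ?thesis
    unfolding diagonal_gap_iff T_i_iff T_ii_iff obstruction_free_def
    unfolding not_ex[symmetric] ex 1 grid_cell_False by blast
qed

text \<open>Reflection turns \<open>T_iii\<close> and \<open>T_iv\<close> into \<open>T_i\<close> and \<open>T_ii\<close>.\<close>

lemma obstruction_free_grid_cell_mirror:
  "obstruction_free (grid_cell True P) \<longleftrightarrow>
    \<not> (\<exists>w C D E F. cell_lower_left w C \<and> cell_upper_right w D \<and>
      cell_upper_left w E \<and> cell_lower_right w F \<and> C \<notin> P \<and> D \<notin> P \<and> E \<in> P \<and> F \<in> P) \<and>
    \<not> contains_translate_of P T_iii \<and> \<not> contains_translate_of P T_iv"
proof -
  have cell_iff: "grid_cell True P i j \<longleftrightarrow> cell (p, q) \<in> P" if "i = - int p - 1" "j = int q" for i j p q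
    using that by auto
  \<comment> \<open>A pattern that spans the columns \<open>i\<close> to \<open>i + c\<close> is the mirror image of one that starts in
    column \<open>p\<close>.\<close>
  have ex: "(\<exists>i j. A i j) \<longleftrightarrow> (\<exists>p q. A (- int (p + c) - 1) (int q))"
    if A: "\<And>i j. A i j \<Longrightarrow> grid_cell True P i j \<and> (\<exists>j'. grid_cell True P (i + int c) j')" for A c
  proof
    assume "\<exists>i j. A i j"
    then obtain i j where "A i j" by blast
    moreover from A[OF this] obtain p q where "i + int c = - int p - 1" "j = int q"
      by (auto simp: grid_cell_def)
    then have "i = - int (p + c) - 1" "j = int q"
      by auto
    ultimately show "\<exists>p q. A (- int (p + c) - 1) (int q)"
      by blast
  qed blast
  have "(\<exists>i j. grid_cell True P i j \<and> grid_cell True P (i + 1) (j + 1) \<and>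
        \<not> grid_cell True P i (j + 1) \<and> \<not> grid_cell True P (i + 1) j) \<longleftrightarrow>
      (\<exists>p q. cell (p + 1, q) \<in> P \<and> cell (p, q + 1) \<in> P \<and> cell (p + 1, q + 1) \<notin> P \<and> cell (p, q) \<notin> P)"
  proof -
    have cells: "grid_cell True P (- int (p + 1) - 1) (int q) \<longleftrightarrow> cell (p + 1, q) \<in> P"
      "grid_cell True P (- int (p + 1) - 1 + 1) (int q + 1) \<longleftrightarrow> cell (p, q + 1) \<in> P"
      "grid_cell True P (- int (p + 1) - 1) (int q + 1) \<longleftrightarrow> cell (p + 1, q + 1) \<in> P"
      "grid_cell True P (- int (p + 1) - 1 + 1) (int q) \<longleftrightarrow> cell (p, q) \<in> P" for p q
      by (rule cell_iff; simp)+
    show ?thesis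
      by (subst ex[where c = 1]) (auto simp only: cells of_nat_1)
  qed
  moreover have "(\<exists>i j. grid_cell True P i j \<and> grid_cell True P (i + 1) j \<and>
        grid_cell True P (i + 1) (j + 1) \<and> grid_cell True P (i + 2) (j + 1)) \<longleftrightarrow>
      (\<exists>p q. cell (p + 2, q) \<in> P \<and> cell (p + 1, q) \<in> P \<and> cell (p + 1, q + 1) \<in> P \<and> cell (p, q + 1) \<in> P)"
  proof -
    have cells: "grid_cell True P (- int (p + 2) - 1) (int q) \<longleftrightarrow> cell (p + 2, q) \<in> P"
      "grid_cell True P (- int (p + 2) - 1 + 1) (int q) \<longleftrightarrow> cell (p + 1, q) \<in> P"
      "grid_cell True P (- int (p + 2) - 1 + 1) (int q + 1) \<longleftrightarrow> cell (p + 1, q + 1) \<in> P"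
      "grid_cell True P (- int (p + 2) - 1 + 2) (int q + 1) \<longleftrightarrow> cell (p, q + 1) \<in> P" for p q
      by (rule cell_iff; simp)+
    show ?thesis
      by (subst ex[where c = 2]) (auto simp only: cells of_nat_numeral)
  qed
  moreover have "(\<exists>i j. grid_cell True P i j \<and> grid_cell True P i (j + 1) \<and>
        grid_cell True P (i + 1) (j + 1) \<and> grid_cell True P (i + 1) (j + 2)) \<longleftrightarrow>
      (\<exists>p q. cell (p + 1, q) \<in> P \<and> cell (p + 1, q + 1) \<in> P \<and> cell (p, q + 1) \<in> P \<and> cell (p, q + 2) \<in> P)"
  proof -
    have cells: "grid_cell True P (- int (p + 1) - 1) (int q) \<longleftrightarrow> cell (p + 1, q) \<in> P"
      "grid_cell True P (- int (p + 1) - 1) (int q + 1) \<longleftrightarrow> cell (p + 1, q + 1) \<in> P"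
      "grid_cell True P (- int (p + 1) - 1 + 1) (int q + 1) \<longleftrightarrow> cell (p, q + 1) \<in> P"
      "grid_cell True P (- int (p + 1) - 1 + 1) (int q + 2) \<longleftrightarrow> cell (p, q + 2) \<in> P" for p q
      by (rule cell_iff; simp)+
    show ?thesis
      by (subst ex[where c = 1]) (auto simp only: cells of_nat_1)
  qed
  ultimately show ?thesis
    unfolding antidiagonal_gap_iff T_iii_iff T_iv_iff obstruction_free_def not_ex[symmetric]
    by blast
qed


text \<open>The inner minors as rules. The left hand side is the diagonal term for \<open>s = False\<close> and
  the antidiagonal one for \<open>s = True\<close>.\<close>

definition minor_rules :: "bool \<Rightarrow> point set set \<Rightarrow> (point mon \<times> point mon) set" where
  "minor_rules s P = {if s
      then (Poly_Mapping.single (x2, y1) 1 + Poly_Mapping.single (x1, y2) 1,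
            Poly_Mapping.single (x2, y2) 1 + Poly_Mapping.single (x1, y1) 1)
      else (Poly_Mapping.single (x1, y1) 1 + Poly_Mapping.single (x2, y2) 1,
            Poly_Mapping.single (x1, y2) 1 + Poly_Mapping.single (x2, y1) 1) | x1 y1 x2 y2.
      inner_interval P (x1, y1) (x2, y2)}"

lemma rules_grid_cell:
  assumes "thin P"
  shows "cell_grid.rules (grid_point s) (grid_cell s P) = minor_rules s P"
proof -
  interpret cell_grid "grid_point s" "\<lambda>v. if s then - int (fst v) else int (fst v)" "\<lambda>v. int (snd v)"
    "grid_cell s P"
    using assms by (rule cell_grid_polyomino)
  show ?thesis
  proof (cases s)
    case False
    have inner_iff: "inner (int x1) (int y1) (int x2) (int y2) \<longleftrightarrow> inner_interval P (x1, y1) (x2, y2)"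
      for x1 y1 x2 y2
    proof
      assume r: "inner (int x1) (int y1) (int x2) (int y2)"
      have "cell (p, q) \<in> P" if "x1 \<le> p" "p < x2" "y1 \<le> q" "q < y2" for p q
        using inner_cell[OF r, of "int p" "int q"] that by (simp add: False)
      with inner_less[OF r] show "inner_interval P (x1, y1) (x2, y2)"
        by (simp add: inner_interval_iff)
    next
      assume r: "inner_interval P (x1, y1) (x2, y2)"
      have "grid_cell s P i j" if "int x1 \<le> i" "i < int x2" "int y1 \<le> j" "j < int y2" for i j
      proof -
        have "cell (nat i, nat j) \<in> P"
          using r that by (simp add: inner_interval_iff nat_less_iff le_nat_iff)
        with that show ?thesis
          unfolding grid_cell_def by (intro exI[of _ "nat i"] exI[of _ "nat j"]) (simp add: False)
      qed
      with r show "inner (int x1) (int y1) (int x2) (int y2)"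
        by (simp add: inner_interval_iff inner_def)
    qed
    have nonneg: "\<exists>x1 y1 x2 y2. i = int x1 \<and> j = int y1 \<and> k = int x2 \<and> l = int y2" if r: "inner i j k l" for i j k l
    proof -
      have "grid_cell s P i j"
        using inner_less[OF r] inner_cell[OF r] by simp
      then have "0 \<le> i" "0 \<le> j"
        by (auto simp: grid_cell_def False)
      with inner_less[OF r] have "i = int (nat i) \<and> j = int (nat j) \<and> k = int (nat k) \<and> l = int (nat l)"
        by simp
      then show ?thesis by blast
    qed
    have "rules = {(xv (int x1) (int y1) + xv (int x2) (int y2), xv (int x1) (int y2) + xv (int x2) (int y1)) |
        x1 y1 x2 y2. inner (int x1) (int y1) (int x2) (int y2)}"
      unfolding rules_def using nonneg by blast
    moreover have "xv (int x) (int y) = Poly_Mapping.single (x, y) 1" for x y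
      unfolding xv_def by (simp add: False grid_point_def)
    ultimately show ?thesis
      unfolding minor_rules_def inner_iff by (simp add: False)
  next
    case True
    have inner_iff: "inner (- int x2) (int y1) (- int x1) (int y2) \<longleftrightarrow> inner_interval P (x1, y1) (x2, y2)"
      for x1 y1 x2 y2
    proof
      assume r: "inner (- int x2) (int y1) (- int x1) (int y2)"
      have "cell (p, q) \<in> P" if "x1 \<le> p" "p < x2" "y1 \<le> q" "q < y2" for p q
      proof -
        have "- int x2 \<le> - int p - 1" "- int p - 1 < - int x1" "int y1 \<le> int q" "int q < int y2"
          using that by linarith+
        from inner_cell[OF r this] have "grid_cell True P (- int p - 1) (int q)"
          by (simp only: True)
        then show ?thesis
          unfolding grid_cell_True .
      qed
      with inner_less[OF r] show "inner_interval P (x1, y1) (x2, y2)"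
        by (simp add: inner_interval_iff)
    next
      assume r: "inner_interval P (x1, y1) (x2, y2)"
      have "grid_cell s P i j" if "- int x2 \<le> i" "i < - int x1" "int y1 \<le> j" "j < int y2" for i j
      proof -
        have "x1 \<le> nat (- i - 1)" "nat (- i - 1) < x2" "y1 \<le> nat j" "nat j < y2"
          using that by linarith+
        then have "cell (nat (- i - 1), nat j) \<in> P"
          using r by (simp add: inner_interval_iff)
        with that show ?thesis
          unfolding grid_cell_def by (intro exI[of _ "nat (- i - 1)"] exI[of _ "nat j"]) (simp add: True)
      qed
      with r show "inner (- int x2) (int y1) (- int x1) (int y2)"
        by (simp add: inner_interval_iff inner_def)
    qed
    have nonneg: "\<exists>x1 y1 x2 y2. i = - int x2 \<and> j = int y1 \<and> k = - int x1 \<and> l = int y2" if r: "inner i j k l" for i j k l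
    proof -
      have "grid_cell s P (k - 1) j"
        using inner_less[OF r] inner_cell[OF r] by simp
      then have "k \<le> 0" "0 \<le> j"
        by (auto simp: grid_cell_def True)
      with inner_less[OF r] have "i = - int (nat (- i)) \<and> j = int (nat j) \<and> k = - int (nat (- k)) \<and> l = int (nat l)"
        by simp
      then show ?thesis by blast
    qed
    have "rules = {(xv (- int x2) (int y1) + xv (- int x1) (int y2), xv (- int x2) (int y2) + xv (- int x1) (int y1)) |
        x1 y1 x2 y2. inner (- int x2) (int y1) (- int x1) (int y2)}"
      unfolding rules_def using nonneg by blast
    moreover have "xv (- int x) (int y) = Poly_Mapping.single (x, y) 1" for x y
      unfolding xv_def by (simp add: True grid_point_def)
    ultimately show ?thesis
      unfolding minor_rules_def inner_iff by (simp add: True)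
  qed
qed


section \<open>Inner minors and their leading terms\<close>

lemma binomials_Collect:
  "binomials {(u x1 y1 x2 y2, v x1 y1 x2 y2) | x1 y1 x2 y2. I x1 y1 x2 y2} =
    {Poly_Mapping.single (u x1 y1 x2 y2) 1 - Poly_Mapping.single (v x1 y1 x2 y2) 1 | x1 y1 x2 y2. I x1 y1 x2 y2}"
  by (auto simp: binomials_def image_iff) blast

lemma inner_minors_eq:
  "(inner_minors P :: (point, 'k::field) mpoly set) =
    (if s then uminus ` binomials (minor_rules s P) else binomials (minor_rules s P))"
proof -
  define m :: "point \<Rightarrow> point \<Rightarrow> (point, 'k) mpoly" where
    "m v w = Poly_Mapping.single (Poly_Mapping.single v 1 + Poly_Mapping.single w 1) 1" for v w
  have var: "var v * var w = m v w" for v w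
    by (simp add: var_def m_def mult_single)
  have "inner_minors P = {m (x1, y1) (x2, y2) - m (x1, y2) (x2, y1) | x1 y1 x2 y2.
      inner_interval P (x1, y1) (x2, y2)}"
    unfolding inner_minors_def var by force
  moreover have "binomials (minor_rules False P) = {m (x1, y1) (x2, y2) - m (x1, y2) (x2, y1) | x1 y1 x2 y2.
      inner_interval P (x1, y1) (x2, y2)}"
    unfolding minor_rules_def m_def by (simp add: binomials_Collect)
  moreover have "uminus ` binomials (minor_rules True P) =
      {m (x1, y1) (x2, y2) - m (x1, y2) (x2, y1) | x1 y1 x2 y2. inner_interval P (x1, y1) (x2, y2)}"
  proof -
    have B: "binomials (minor_rules True P) = {m (x1, y2) (x2, y1) - m (x1, y1) (x2, y2) | x1 y1 x2 y2.
        inner_interval P (x1, y1) (x2, y2)}"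
      unfolding minor_rules_def m_def by (simp add: binomials_Collect add.commute)
    have neg: "uminus ` {f x1 y1 x2 y2 | x1 y1 x2 y2. I x1 y1 x2 y2} =
        {- f x1 y1 x2 y2 | x1 y1 x2 y2. I x1 y1 x2 y2}" for f :: "_ \<Rightarrow> _ \<Rightarrow> _ \<Rightarrow> _ \<Rightarrow> (point, 'k) mpoly" and I
      by blast
    show ?thesis
      unfolding B neg[of "\<lambda>x1 y1 x2 y2. m (x1, y2) (x2, y1) - m (x1, y1) (x2, y2)"
        "\<lambda>x1 y1 x2 y2. inner_interval P (x1, y1) (x2, y2)"] by (simp only: minus_diff_eq)
  qed
  ultimately show ?thesis
    by (cases s) simp_all
qed

lemma genideal_uminus:
  fixes B :: "('v, 'k::comm_ring_1) mpoly set"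
  assumes "B \<subseteq> carrier (poly_ring V)"
  shows "Idl\<^bsub>poly_ring V\<^esub> (uminus ` B) = Idl\<^bsub>poly_ring V\<^esub> B"
proof -
  have neg: "- f \<in> J" if "ideal J (poly_ring V)" "f \<in> J" for J and f :: "('v, 'k) mpoly"
  proof -
    have "Poly_Mapping.single 0 (- 1) \<in> carrier (poly_ring V :: ('v, 'k) mpoly ring)"
      by (rule single_in_poly_ring) simp
    with that have "Poly_Mapping.single 0 (- 1) * f \<in> J"
      unfolding ideal_poly_ring_iff by blast
    then show ?thesis
      by (simp add: single_uminus)
  qed
  have "uminus ` B \<subseteq> J \<longleftrightarrow> B \<subseteq> J" if J: "ideal J (poly_ring V)" for J
  proof
    assume sub: "uminus ` B \<subseteq> J"
    show "B \<subseteq> J"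
    proof
      fix f assume "f \<in> B"
      then have "- f \<in> J"
        using sub by blast
      from neg[OF J this] show "f \<in> J" by simp
    qed
  qed (use neg[OF J] in blast)
  then have "{J. ideal J (poly_ring V) \<and> uminus ` B \<subseteq> J} = {J. ideal J (poly_ring V) \<and> B \<subseteq> J}"
    by blast
  then show ?thesis
    by (simp add: genideal_def)
qed

text \<open>
  The choice of signs: whichever sign the elements of \<open>M\<close> have, normalising them to leading coefficient
  1 gives the binomials of the rules.
\<close>

lemma (in binomial_rules) signed_binomials_eq:
  fixes M :: "('v, 'k::field) mpoly set"
  assumes "M = (if s then uminus ` binomials R else binomials R)"
  shows "{f. (f \<in> M \<or> - f \<in> M) \<and> lead_coef less f = 1} = binomials R"
proof -
  have M: "f \<in> M \<or> - f \<in> M \<longleftrightarrow> f \<in> binomials R \<or> - f \<in> binomials R" for f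
    using assms by (auto simp: image_iff) (metis add.inverse_inverse)+
  have one: "lead_coef less f = 1" if "f \<in> binomials R" for f :: "('v, 'k) mpoly"
    using that by (auto simp: binomials_def lead_coef_binomial)
  have "f \<in> binomials R" if "- f \<in> binomials R" "lead_coef less f = 1" for f :: "('v, 'k) mpoly"
  proof -
    have "lead_coef less (- f) = - lead_coef less f"
      by (simp add: lead_coef_def lead_mon_def)
    with one[OF that(1)] that(2) have minus_one: "- 1 = (1 :: 'k)"
      by simp
    \<comment> \<open>The characteristic is 2, so signs do not matter.\<close>
    have "- f = f"
    proof (rule poly_mapping_eqI)
      fix m
      have "- Poly_Mapping.lookup f m = (- 1) * Poly_Mapping.lookup f m"
        by simp
      then show "Poly_Mapping.lookup (- f) m = Poly_Mapping.lookup f m"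
        by (simp add: minus_one del: mult_minus_left)
    qed
    with that(1) show ?thesis by simp
  qed
  with one show ?thesis
    unfolding M by blast
qed

lemma monomial_order_vertex_less:
  assumes "i \<in> {1, 2, 3, 4, 5, 6, 7, 8}"
  shows "monomial_order (grevlex (vertex_less i))"
proof (rule monomial_order_grevlex)
  fix u v w :: point
  show "\<not> vertex_less i v v"
    by (simp add: vertex_less_def)
  show "vertex_less i u w" if "vertex_less i u v" "vertex_less i v w"
    using that by (auto simp: vertex_less_def split: if_splits)
  show "vertex_less i v w \<or> vertex_less i w v" if "v \<noteq> w"
    using that assms by (auto simp: vertex_less_def prod_eq_iff)
qed

text \<open>In degree two, the monomial that contains the smallest of the variables is the smaller one.\<close>

lemma grevlex_pair:
  assumes "lt c a" "lt c b" "lt c d" and irrefl: "\<And>v. \<not> lt v v"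
    and asym: "\<And>v w. lt v w \<Longrightarrow> \<not> lt w v"
  shows "grevlex lt (Poly_Mapping.single c 1 + Poly_Mapping.single d 1)
    (Poly_Mapping.single a 1 + Poly_Mapping.single b 1)"
  unfolding grevlex_def
proof (intro disjI2 conjI exI[of _ c] allI impI)
  show "Poly_Mapping.lookup (Poly_Mapping.single a 1 + Poly_Mapping.single b 1) c
      < Poly_Mapping.lookup (Poly_Mapping.single c (1::nat) + Poly_Mapping.single d 1) c"
    using assms by (auto simp: lookup_add lookup_single when_def)
  fix w assume "lt w c"
  then have "w \<noteq> a" "w \<noteq> b" "w \<noteq> c" "w \<noteq> d"
    using assms by metis+
  then show "Poly_Mapping.lookup (Poly_Mapping.single c (1::nat) + Poly_Mapping.single d 1) w =
      Poly_Mapping.lookup (Poly_Mapping.single a 1 + Poly_Mapping.single b 1) w"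
    by (simp add: lookup_add lookup_single when_def)
qed (simp add: mon_deg_add)

lemma binomial_rules_minor_rules:
  assumes P: "polyomino P" and i: "i \<in> (if s then {2, 4, 6, 8} else {1, 3, 5, 7})"
  shows "binomial_rules (grevlex (vertex_less i)) (vertices P) (minor_rules s P)"
proof (intro binomial_rules.intro binomial_rules_axioms.intro)
  show "monomial_order (grevlex (vertex_less i))"
    using i by (intro monomial_order_vertex_less) (auto split: if_splits)
  let ?f = "\<lambda>((x1, y1), (x2, y2)). if s
      then (Poly_Mapping.single (x2, y1) 1 + Poly_Mapping.single (x1, y2) 1,
            Poly_Mapping.single (x2, y2) 1 + Poly_Mapping.single (x1, y1) (1::nat))
      else (Poly_Mapping.single (x1, y1) 1 + Poly_Mapping.single (x2, y2) 1,
            Poly_Mapping.single (x1, y2) 1 + Poly_Mapping.single (x2, y1) (1::nat))"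
  have "minor_rules s P \<subseteq> ?f ` (vertices P \<times> vertices P)"
  proof
    fix r assume "r \<in> minor_rules s P"
    then obtain x1 y1 x2 y2 where "inner_interval P (x1, y1) (x2, y2)" "r = ?f ((x1, y1), (x2, y2))"
      unfolding minor_rules_def by auto
    with inner_interval_vertices show "r \<in> ?f ` (vertices P \<times> vertices P)"
      by (intro image_eqI[of _ _ "((x1, y1), (x2, y2))"]) auto
  qed
  then show "finite (minor_rules s P)"
    using finite_vertices[OF P] by (meson finite_SigmaI finite_imageI finite_subset)
next
  fix u v assume "(u, v) \<in> minor_rules s P"
  then obtain x1 y1 x2 y2 where I: "inner_interval P (x1, y1) (x2, y2)"
    and uv: "(u, v) = (if s
      then (Poly_Mapping.single (x2, y1) 1 + Poly_Mapping.single (x1, y2) 1,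
            Poly_Mapping.single (x2, y2) 1 + Poly_Mapping.single (x1, y1) 1)
      else (Poly_Mapping.single (x1, y1) 1 + Poly_Mapping.single (x2, y2) 1,
            Poly_Mapping.single (x1, y2) 1 + Poly_Mapping.single (x2, y1) 1))"
    unfolding minor_rules_def by auto
  show "Poly_Mapping.keys u \<subseteq> vertices P \<and> Poly_Mapping.keys v \<subseteq> vertices P"
    using uv inner_interval_vertices[OF I] by (auto simp: keys_add_nat split: if_splits)
  have less: "x1 < x2" "y1 < y2"
    using I by (simp_all add: inner_interval_iff)
  have pair: "grevlex (vertex_less i) (Poly_Mapping.single c 1 + Poly_Mapping.single d 1)
      (Poly_Mapping.single a 1 + Poly_Mapping.single b 1)"
    if "vertex_less i c a" "vertex_less i c b" "vertex_less i c d" for a b c d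
    using that by (rule grevlex_pair) (auto simp: vertex_less_def split: if_splits)
  have pair': "grevlex (vertex_less i) (Poly_Mapping.single c 1 + Poly_Mapping.single d 1)
      (Poly_Mapping.single a 1 + Poly_Mapping.single b 1)"
    if "vertex_less i d a" "vertex_less i d b" "vertex_less i d c" for a b c d
    using pair[OF that] by (simp add: add.commute)
  \<comment> \<open>The smallest corner of a rectangle is a diagonal one for even \<open>i\<close> and an antidiagonal one for
    odd \<open>i\<close>.\<close>
  show "grevlex (vertex_less i) v u"
  proof (cases s)
    case True
    then have "i \<in> {2, 8} \<or> i \<in> {4, 6}"
      using i by auto
    then show ?thesis
    proof
      assume "i \<in> {2, 8}"
      with less uv True show ?thesis
        using pair[of "(x2, y2)" "(x2, y1)" "(x1, y2)" "(x1, y1)"] by (auto simp: vertex_less_def)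
    next
      assume "i \<in> {4, 6}"
      with less uv True show ?thesis
        using pair'[of "(x1, y1)" "(x2, y1)" "(x1, y2)" "(x2, y2)"] by (auto simp: vertex_less_def)
    qed
  next
    case False
    then have "i \<in> {1, 7} \<or> i \<in> {3, 5}"
      using i by auto
    then show ?thesis
    proof
      assume "i \<in> {1, 7}"
      with less uv False show ?thesis
        using pair[of "(x1, y2)" "(x1, y1)" "(x2, y2)" "(x2, y1)"] by (auto simp: vertex_less_def)
    next
      assume "i \<in> {3, 5}"
      with less uv False show ?thesis
        using pair'[of "(x2, y1)" "(x1, y1)" "(x2, y2)" "(x1, y2)"] by (auto simp: vertex_less_def)
    qed
  qed
qed

theorem reduced_groebner_basis_inner_minors_iff:
  assumes "polyomino P" "thin P" and i: "i \<in> (if s then {2, 4, 6, 8} else {1, 3, 5, 7})"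
  shows "reduced_groebner_basis (vertices P) (grevlex (vertex_less i))
      (polyomino_ideal P :: (point, 'k::field) mpoly set)
      (signed_inner_minors (grevlex (vertex_less i)) P) \<longleftrightarrow>
    obstruction_free (grid_cell s P)"
proof -
  interpret grid: cell_grid "grid_point s" "\<lambda>v. if s then - int (fst v) else int (fst v)"
    "\<lambda>v. int (snd v)" "grid_cell s P"
    using assms(2) by (rule cell_grid_polyomino)
  interpret binomial_rules "grevlex (vertex_less i)" "vertices P" "minor_rules s P"
    using assms(1,3) by (rule binomial_rules_minor_rules)
  let ?B = "binomials (minor_rules s P) :: (point, 'k) mpoly set"
  have "polyomino_ideal P = Idl\<^bsub>poly_ring (vertices P)\<^esub> ?B"
    unfolding polyomino_ideal_def inner_minors_eq[of P s]
    using genideal_uminus[OF binomials_carrier] by (cases s) simp_all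
  moreover have "signed_inner_minors (grevlex (vertex_less i)) P = ?B"
    unfolding signed_inner_minors_def by (rule signed_binomials_eq[OF inner_minors_eq[of P s]])
  ultimately show ?thesis
    using grid.reduced_groebner_basis_iff[of "grevlex (vertex_less i)" "vertices P"]
      binomial_rules_axioms
    by (simp add: rules_grid_cell[OF assms(2)])
qed

theorem theorem3p4:
  fixes P :: "point set set"
  assumes "polyomino P" and "thin P"
  shows
    "(\<forall>i\<in>{1, 3, 5, 7}.
        reduced_groebner_basis (vertices P) (grevlex (vertex_less i))
          (polyomino_ideal P :: (point, 'k::field) mpoly set)
          (signed_inner_minors (grevlex (vertex_less i)) P) \<longleftrightarrow>
        \<not> (\<exists>w C D E F. cell_upper_left w C \<and> cell_lower_right w D \<and>
              cell_lower_left w E \<and> cell_upper_right w F \<and>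
              C \<notin> P \<and> D \<notin> P \<and> E \<in> P \<and> F \<in> P) \<and>
        \<not> contains_translate_of P T_i \<and> \<not> contains_translate_of P T_ii) \<and>
     (\<forall>i\<in>{2, 4, 6, 8}.
        reduced_groebner_basis (vertices P) (grevlex (vertex_less i))
          (polyomino_ideal P :: (point, 'k::field) mpoly set)
          (signed_inner_minors (grevlex (vertex_less i)) P) \<longleftrightarrow>
        \<not> (\<exists>w C D E F. cell_lower_left w C \<and> cell_upper_right w D \<and>
              cell_upper_left w E \<and> cell_lower_right w F \<and>
              C \<notin> P \<and> D \<notin> P \<and> E \<in> P \<and> F \<in> P) \<and>
        \<not> contains_translate_of P T_iii \<and> \<not> contains_translate_of P T_iv)"
proof (intro conjI ballI, goal_cases)
  case (1 i)
  then have "i \<in> (if False then {2, 4, 6, 8} else {1, 3, 5, 7})"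
    by simp
  from reduced_groebner_basis_inner_minors_iff[OF assms this] show ?case
    unfolding obstruction_free_grid_cell .
next
  case (2 i)
  then have "i \<in> (if True then {2, 4, 6, 8} else {1, 3, 5, 7})"
    by simp
  from reduced_groebner_basis_inner_minors_iff[OF assms this] show ?case
    unfolding obstruction_free_grid_cell_mirror .
qed

end
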